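(* Let $A$ be an approximately unital Banach algebra in which hermitian idempotents are ultrahermitian and commute with each other. Then $\mathfrak{S}_{\mathrm{pi}}(A)$ is an inverse semigroup with (well-defined) multiplication given by $[a][b]:=[ab]$ for $a,b\in\mathrm{PI}_{\mathrm{MP}}(A)$. In this inverse semigroup, $[a]^\dagger=[a^\dagger]$ for all $a\in\mathrm{PI}_{\mathrm{MP}}(A)$. Moreover, the quotient map $\mathrm{PI}_{\mathrm{MP}}(A)\to\mathfrak{S}_{\mathrm{pi}}(A)$ is a homomorphism of inverse semigroups. This applies to every approximately unital $L^p$-operator algebra for $p\in(1,\infty)\setminus\{2\}$, as well as to every approximately unital $L^1$-operator algebra that admits a nondegenerate, isometric representation on some $L^1$-space.
   Context: Banach algebras are complex; a unital Banach algebra has a contractive unit. $A_1$ denotes the set of contractive elements ($\|a\|\le1$). $A$ is approximately unital if there is a net $(e_j)$ in $A_1$ with $ae_j\to a$ and $e_ja\to a$ for all $a\in A$. The minimal multiplier unitization $\widetilde{A}$ is $A$ itself if $A$ is unital, and otherwise $\widetilde{A}=A+\mathbb{C}1$ with norm $\|a+\mu1\|=\sup_{b\in A_1}\|ab+\mu b\|$; $A$ embeds isometrically as a closed two-sided ideal. An element $a$ of a unital Banach algebra is hermitian if $\|\exp(ita)\|=1$ for all $t\in\mathbb{R}$; an element of an approximately unital $A$ is hermitian if it is hermitian in $\widetilde{A}$. $A_{\mathrm{h}}$ is the set of hermitian elements. An idempotent $e$ in a unital Banach algebra $B$ is ultrahermitian if $\|eae+(1-e)b(1-e)\|\le1$ for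 all $a,b\in B_1$; an idempotent in an approximately unital $A$ is ultrahermitian if it is so in $\widetilde{A}$. An element $a\in A$ is Moore-Penrose invertible if there is $b\in A$ with $a=aba$, $b=bab$ and $ab,ba\in A_{\mathrm{h}}$; such $b$ is unique and denoted $a^\dagger$. $\mathrm{PI}_{\mathrm{MP}}(A)$ is the set of MP-partial isometries: Moore-Penrose invertible $a\in A$ with $\|a\|\le1$ and $\|a^\dagger\|\le1$. Under the hypotheses of the theorem, $\mathrm{PI}_{\mathrm{MP}}(A)$ is an inverse semigroup under multiplication. Elements $a_0,a_1\in\mathrm{PI}_{\mathrm{MP}}(A)$ are homotopic, $a_0\simeq a_1$, if there is a norm-continuous path $[0,1]\to\mathrm{PI}_{\mathrm{MP}}(A)$ from $a_0$ to $a_1$. $\mathfrak{S}_{\mathrm{pi}}(A):=\mathrm{PI}_{\mathrm{MP}}(A)/\!\simeq$, with $[a]$ the class of $a$. An inverse semigroup is a semigroup in which every $s$ has a unique $t=s^\dagger$ with $s=sts$, $t=tst$. An $L^p$-operator algebra is a Banach algebra admitting an isometric representation on some $L^p$-space $E$; a representation $\varphi\colon A\to\mathcal{B}(E)$ is nondegenerate if the linear span of $\varphi(A)E$ is dense in $E$. *)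

theory Defs
  imports "HOL-Analysis.Analysis"
begin

section \<open>Complex Banach algebras\<close>

class scaleC = scaleR +
  fixes scaleC :: "complex \<Rightarrow> 'a \<Rightarrow> 'a" (infixr "*\<^sub>C" 75)
  assumes scaleR_scaleC: "scaleR r = scaleC (complex_of_real r)"

class complex_vector = scaleC + real_vector +
  assumes scaleC_add_right: "c *\<^sub>C (x + y) = c *\<^sub>C x + c *\<^sub>C y"
    and scaleC_add_left: "(c + d) *\<^sub>C x = c *\<^sub>C x + d *\<^sub>C x"
    and scaleC_scaleC: "c *\<^sub>C (d *\<^sub>C x) = (c * d) *\<^sub>C x"
    and scaleC_one: "1 *\<^sub>C x = x"

class complex_banach = complex_vector + real_normed_vector + banach +
  assumes norm_scaleC: "norm (c *\<^sub>C x) = cmod c * norm x"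

text \<open>As for \<^class>\<open>real_normed_algebra\<close>, no unit is assumed.\<close>

class complex_banach_algebra = complex_banach + real_normed_algebra +
  assumes mult_scaleC_left: "(c *\<^sub>C x) * y = c *\<^sub>C (x * y)"
    and mult_scaleC_right: "x * (c *\<^sub>C y) = c *\<^sub>C (x * y)"

instantiation complex :: complex_vector
begin
definition scaleC_complex :: "complex \<Rightarrow> complex \<Rightarrow> complex"
  where "scaleC_complex c z = c * z"
instance
  by standard (auto simp: scaleC_complex_def scaleR_conv_of_real algebra_simps fun_eq_iff)
end

instantiation prod :: (complex_vector, complex_vector) complex_vector
begin
definition scaleC_prod :: "complex \<Rightarrow> 'a \<times> 'b \<Rightarrow> 'a \<times> 'b"
  where "scaleC_prod c x = (c *\<^sub>C fst x, c *\<^sub>C snd x)"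
instance
  by standard
    (auto simp: scaleC_prod_def scaleR_prod_def fun_eq_iff scaleR_scaleC
      scaleC_add_right scaleC_add_left scaleC_scaleC scaleC_one)
end

definition unit_of :: "'a::complex_banach_algebra \<Rightarrow> bool" where
  "unit_of u \<longleftrightarrow> norm u \<le> 1 \<and> (\<forall>a. u * a = a \<and> a * u = a)"

definition unital :: "'a::complex_banach_algebra itself \<Rightarrow> bool" where
  "unital _ \<longleftrightarrow> (\<exists>u::'a. unit_of u)"

text \<open>Nets of contractive elements are rendered as proper filters containing the closed unit ball:
  a net induces its filter of tails, and every proper filter is the filter of tails of a net.\<close>

definition approximately_unital :: "'a::complex_banach_algebra itself \<Rightarrow> bool" where
  "approximately_unital _ \<longleftrightarrow>
    (\<exists>F::'a filter. F \<noteq> bot \<and> (\<forall>\<^sub>F e in F. norm e \<le> 1) \<and>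
      (\<forall>a. ((\<lambda>e. a * e) \<longlongrightarrow> a) F \<and> ((\<lambda>e. e * a) \<longlongrightarrow> a) F))"


section \<open>Hermitian elements and ultrahermitian idempotents of a unital Banach algebra\<close>

text \<open>Unital Banach algebras are represented by an explicit carrier, multiplication, unit and norm,
  because the unitization of \<open>'a\<close> depends on whether \<open>'a\<close> is unital. In addition, the class
  \<^class>\<open>real_normed_algebra_1\<close>, on which \<^const>\<open>exp\<close> is defined, excludes the
  zero algebra. The linear structure is that of the ambient type.\<close>

record 'b unital_alg =
  carrier :: "'b set"
  mult :: "'b \<Rightarrow> 'b \<Rightarrow> 'b"
  unt :: 'b
  nrm :: "'b \<Rightarrow> real"

primrec alg_power :: "'b unital_alg \<Rightarrow> 'b \<Rightarrow> nat \<Rightarrow> 'b" where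
  "alg_power B x 0 = unt B"
| "alg_power B x (Suc n) = mult B x (alg_power B x n)"

definition alg_exp :: "'b::complex_vector unital_alg \<Rightarrow> 'b \<Rightarrow> 'b" where
  "alg_exp B x = (THE y. y \<in> carrier B \<and>
    (\<lambda>n. nrm B ((\<Sum>k<n. (1 / fact k) *\<^sub>C alg_power B x k) - y)) \<longlonglongrightarrow> 0)"

definition hermitian_in :: "'b::complex_vector unital_alg \<Rightarrow> 'b \<Rightarrow> bool" where
  "hermitian_in B a \<longleftrightarrow> a \<in> carrier B \<and>
    (\<forall>t::real. nrm B (alg_exp B ((\<i> * complex_of_real t) *\<^sub>C a)) = 1)"

definition ultrahermitian_in :: "'b::complex_vector unital_alg \<Rightarrow> 'b \<Rightarrow> bool" where
  "ultrahermitian_in B e \<longleftrightarrow> e \<in> carrier B \<and> mult B e e = e \<and>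
    (\<forall>a\<in>carrier B. \<forall>b\<in>carrier B. nrm B a \<le> 1 \<longrightarrow> nrm B b \<le> 1 \<longrightarrow>
      nrm B (mult B (mult B e a) e + mult B (mult B (unt B - e) b) (unt B - e)) \<le> 1)"


section \<open>The minimal multiplier unitization\<close>

text \<open>The pair \<open>(a, \<mu>)\<close> stands for \<open>a + \<mu>1\<close>. If \<open>'a\<close> is unital, then
  the unitization is the copy of \<open>'a\<close> consisting of the pairs \<open>(a, 0)\<close>.\<close>

definition unitization :: "'a::complex_banach_algebra itself \<Rightarrow> ('a \<times> complex) unital_alg" where
  "unitization _ = \<lparr>
     carrier = (if unital TYPE('a) then UNIV \<times> {0} else UNIV),
     mult = (\<lambda>(a, \<mu>) (b, \<nu>). (a * b + \<mu> *\<^sub>C b + \<nu> *\<^sub>C a, \<mu> * \<nu>)),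
     unt = (if unital TYPE('a) then (THE u. unit_of u, 0) else (0, 1)),
     nrm = (\<lambda>(a, \<mu>). if unital TYPE('a) then norm a
                       else (SUP b\<in>{b. norm b \<le> 1}. norm (a * b + \<mu> *\<^sub>C b)))\<rparr>"

definition hermitian :: "'a::complex_banach_algebra \<Rightarrow> bool" where
  "hermitian a \<longleftrightarrow> hermitian_in (unitization TYPE('a)) (a, 0)"

definition ultrahermitian :: "'a::complex_banach_algebra \<Rightarrow> bool" where
  "ultrahermitian e \<longleftrightarrow> ultrahermitian_in (unitization TYPE('a)) (e, 0)"

definition hermitian_idempotent :: "'a::complex_banach_algebra \<Rightarrow> bool" where
  "hermitian_idempotent e \<longleftrightarrow> hermitian e \<and> e * e = e"

definition hermitian_idempotents_ultrahermitian_and_commute ::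
    "'a::complex_banach_algebra itself \<Rightarrow> bool" where
  "hermitian_idempotents_ultrahermitian_and_commute _ \<longleftrightarrow>
    (\<forall>e::'a. hermitian_idempotent e \<longrightarrow> ultrahermitian e) \<and>
    (\<forall>(e::'a) f. hermitian_idempotent e \<longrightarrow> hermitian_idempotent f \<longrightarrow> e * f = f * e)"


section \<open>MP-partial isometries and their homotopy classes\<close>

definition is_mp_inverse :: "'a::complex_banach_algebra \<Rightarrow> 'a \<Rightarrow> bool" where
  "is_mp_inverse a b \<longleftrightarrow>
    a = a * b * a \<and> b = b * a * b \<and> hermitian (a * b) \<and> hermitian (b * a)"

definition mp_invertible :: "'a::complex_banach_algebra \<Rightarrow> bool" where
  "mp_invertible a \<longleftrightarrow> (\<exists>b. is_mp_inverse a b)"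

definition mp_inverse :: "'a::complex_banach_algebra \<Rightarrow> 'a" where
  "mp_inverse a = (THE b. is_mp_inverse a b)"

definition PI_MP :: "'a::complex_banach_algebra set" where
  "PI_MP = {a. mp_invertible a \<and> norm a \<le> 1 \<and> norm (mp_inverse a) \<le> 1}"

definition homotopic :: "'a::complex_banach_algebra \<Rightarrow> 'a \<Rightarrow> bool" where
  "homotopic a b \<longleftrightarrow> path_component PI_MP a b"

definition homotopy_rel :: "('a::complex_banach_algebra \<times> 'a) set" where
  "homotopy_rel = {(a, b). homotopic a b}"

lemma equiv_homotopy_rel: "equiv PI_MP homotopy_rel"
  unfolding equiv_def refl_on_def sym_def trans_def homotopy_rel_def homotopic_def
  by (auto intro: path_component_refl path_component_sym path_component_trans
      dest: path_component_mem)

definition S_pi :: "'a::complex_banach_algebra set set" where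
  "S_pi = PI_MP // homotopy_rel"

definition pi_class :: "'a::complex_banach_algebra \<Rightarrow> 'a set" where
  "pi_class a = homotopy_rel `` {a}"

text \<open>The value is only meaningful if the class of \<open>a * b\<close> does not depend on the choice of
  representatives.\<close>

definition S_pi_mult :: "'a::complex_banach_algebra set \<Rightarrow> 'a set \<Rightarrow> 'a set" where
  "S_pi_mult X Y = (THE Z. \<exists>a\<in>X. \<exists>b\<in>Y. Z = pi_class (a * b))"


section \<open>Inverse semigroups\<close>

definition is_inverse :: "'s set \<Rightarrow> ('s \<Rightarrow> 's \<Rightarrow> 's) \<Rightarrow> 's \<Rightarrow> 's \<Rightarrow> bool" where
  "is_inverse S m s t \<longleftrightarrow> t \<in> S \<and> s = m (m s t) s \<and> t = m (m t s) t"

definition inverse_semigroup :: "'s set \<Rightarrow> ('s \<Rightarrow> 's \<Rightarrow> 's) \<Rightarrow> bool" where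
  "inverse_semigroup S m \<longleftrightarrow>
    (\<forall>x\<in>S. \<forall>y\<in>S. m x y \<in> S) \<and>
    (\<forall>x\<in>S. \<forall>y\<in>S. \<forall>z\<in>S. m (m x y) z = m x (m y z)) \<and>
    (\<forall>s\<in>S. \<exists>!t. is_inverse S m s t)"

definition dagger :: "'s set \<Rightarrow> ('s \<Rightarrow> 's \<Rightarrow> 's) \<Rightarrow> 's \<Rightarrow> 's" where
  "dagger S m s = (THE t. is_inverse S m s t)"

definition inverse_semigroup_hom ::
    "'s set \<Rightarrow> ('s \<Rightarrow> 's \<Rightarrow> 's) \<Rightarrow> 't set \<Rightarrow> ('t \<Rightarrow> 't \<Rightarrow> 't) \<Rightarrow> ('s \<Rightarrow> 't) \<Rightarrow> bool" where
  "inverse_semigroup_hom S m T n f \<longleftrightarrow>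
    inverse_semigroup S m \<and> inverse_semigroup T n \<and> f \<in> S \<rightarrow> T \<and>
    (\<forall>x\<in>S. \<forall>y\<in>S. f (m x y) = n (f x) (f y)) \<and>
    (\<forall>x\<in>S. f (dagger S m x) = dagger T n (f x))"


section \<open>Algebras of operators on \<open>L\<^sup>p\<close>-spaces\<close>

definition Lp_functions :: "real \<Rightarrow> 'm measure \<Rightarrow> ('m \<Rightarrow> complex) set" where
  "Lp_functions p M =
    {f \<in> borel_measurable M. integrable M (\<lambda>x. cmod (f x) powr p)}"

definition Lp_norm :: "real \<Rightarrow> 'm measure \<Rightarrow> ('m \<Rightarrow> complex) \<Rightarrow> real" where
  "Lp_norm p M f = (LINT x|M. cmod (f x) powr p) powr (1 / p)"

text \<open>The Banach space \<open>'e\<close> is (isometrically isomorphic to) \<open>L\<^sup>p(M)\<close>, the quotient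
  of the \<open>p\<close>-integrable functions by the null functions; \<open>q\<close> is the quotient map.\<close>

definition is_Lp_space :: "'e::complex_banach itself \<Rightarrow> real \<Rightarrow> 'm measure \<Rightarrow> bool" where
  "is_Lp_space _ p M \<longleftrightarrow>
    (\<exists>q::('m \<Rightarrow> complex) \<Rightarrow> 'e.
      (\<forall>f\<in>Lp_functions p M. \<forall>g\<in>Lp_functions p M. q (\<lambda>x. f x + g x) = q f + q g) \<and>
      (\<forall>c. \<forall>f\<in>Lp_functions p M. q (\<lambda>x. c * f x) = c *\<^sub>C q f) \<and>
      (\<forall>f\<in>Lp_functions p M. norm (q f) = Lp_norm p M f) \<and>
      q ` Lp_functions p M = UNIV)"

text \<open>The complex-linear bounded operators on \<open>'e\<close> are the elements of the library type of
  real-linear bounded operators that commute with complex scalars.\<close>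

definition representation ::
    "('a::complex_banach_algebra \<Rightarrow> ('e::complex_banach \<Rightarrow>\<^sub>L 'e)) \<Rightarrow> bool" where
  "representation \<phi> \<longleftrightarrow>
    (\<forall>a c x. blinfun_apply (\<phi> a) (c *\<^sub>C x) = c *\<^sub>C blinfun_apply (\<phi> a) x) \<and>
    (\<forall>a b. \<phi> (a + b) = \<phi> a + \<phi> b) \<and>
    (\<forall>c a x. blinfun_apply (\<phi> (c *\<^sub>C a)) x = c *\<^sub>C blinfun_apply (\<phi> a) x) \<and>
    (\<forall>a b. \<phi> (a * b) = \<phi> a o\<^sub>L \<phi> b)"

definition isometric_representation ::
    "('a::complex_banach_algebra \<Rightarrow> ('e::complex_banach \<Rightarrow>\<^sub>L 'e)) \<Rightarrow> bool" where
  "isometric_representation \<phi> \<longleftrightarrow> representation \<phi> \<and> (\<forall>a. norm (\<phi> a) = norm a)"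

text \<open>The set \<open>\<phi>(A)E\<close> is closed under complex scalars, so its real span is its complex
  span.\<close>

definition nondegenerate ::
    "('a::complex_banach_algebra \<Rightarrow> ('e::complex_banach \<Rightarrow>\<^sub>L 'e)) \<Rightarrow> bool" where
  "nondegenerate \<phi> \<longleftrightarrow> closure (span {blinfun_apply (\<phi> a) x | a x. True}) = UNIV"

text \<open>HOL has no quantification over types, so the types \<open>'e\<close> of the \<open>L\<^sup>p\<close>-space and
  \<open>'m\<close> of the underlying measure space are parameters.\<close>

definition Lp_operator_algebra ::
    "'a::complex_banach_algebra itself \<Rightarrow> 'e::complex_banach itself \<Rightarrow> 'm itself \<Rightarrow> real \<Rightarrow> bool"
  where
  "Lp_operator_algebra _ _ _ p \<longleftrightarrow>
    (\<exists>M::'m measure. is_Lp_space TYPE('e) p M) \<and>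
    (\<exists>\<phi>::'a \<Rightarrow> ('e \<Rightarrow>\<^sub>L 'e). isometric_representation \<phi>)"

definition nondegenerate_Lp_operator_algebra ::
    "'a::complex_banach_algebra itself \<Rightarrow> 'e::complex_banach itself \<Rightarrow> 'm itself \<Rightarrow> real \<Rightarrow> bool"
  where
  "nondegenerate_Lp_operator_algebra _ _ _ p \<longleftrightarrow>
    (\<exists>M::'m measure. is_Lp_space TYPE('e) p M) \<and>
    (\<exists>\<phi>::'a \<Rightarrow> ('e \<Rightarrow>\<^sub>L 'e). isometric_representation \<phi> \<and> nondegenerate \<phi>)"

end

theory Submission
  imports Defs
begin

text \<open>If \<open>e = a a\<^sup>\<dagger>\<close> is ultrahermitian and \<open>f\<close> is a hermitian idempotent, then \<open>exp (\<i> t a f a\<^sup>\<dagger>)\<close> is the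
  sum of a contraction \<open>e x e\<close> and of \<open>1 - e\<close>, so it is contractive. Hence \<open>b\<^sup>\<dagger> a\<^sup>\<dagger>\<close> is the
  Moore-Penrose inverse of \<open>a b\<close>, the MP-partial isometries form a semigroup, and its idempotents are
  hermitian and therefore commute. By Lallement's lemma, idempotents lift along the quotient map to
  homotopy classes, so they commute in the quotient as well.

  Let \<open>A\<close> act on \<open>L\<^sup>p\<close> and let \<open>E\<close> be the essential subspace, on which the unitization acts
  isometrically. For a hermitian idempotent with operator \<open>P\<close>, all \<open>P + z (1 - P)\<close> with
  \<open>\<bar>z\<bar> = 1\<close> are isometries of \<open>E\<close>, and the Gateaux derivatives of the norm are equivariant under
  them. Consequently, for \<open>f\<close> in the range and \<open>g\<close> in the kernel of \<open>P\<close>, the derivatives at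
  \<open>f + z g\<close>, as functionals on \<open>E\<close>, are affine in the conjugate of \<open>z\<close>. If \<open>p > 1\<close>, smoothness
  of the norm lets the approximate identity extend this from \<open>E\<close> to \<open>L\<^sup>p\<close>. Testing against
  restrictions of \<open>f\<close> and \<open>g\<close> to measurable sets shows that \<open>\<bar>f + z g\<bar>\<^sup>p + \<bar>f - z g\<bar>\<^sup>p\<close> does not depend
  on \<open>z\<close>, almost everywhere. Since \<open>p \<noteq> 2\<close>, this forces \<open>f g = 0\<close>. So \<open>P\<close> acts on every vector
  as the restriction to a set, from which both properties follow.\<close>


section \<open>Inverse semigroups\<close>

text \<open>Two inverses \<open>t\<close>, \<open>u\<close> of \<open>s\<close> make
  \<open>s t\<close> and \<open>s u\<close> idempotents with \<open>(s t)(s u) = s u\<close> and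
  \<open>(s u)(s t) = s t\<close>, so commutation identifies them; the same works on the other side.
  The function \<open>j\<close> is some choice of inverses.\<close>

lemma inverse_semigroupI:
  assumes cl: "\<And>x y. x \<in> S \<Longrightarrow> y \<in> S \<Longrightarrow> m x y \<in> S"
    and as: "\<And>x y z. x \<in> S \<Longrightarrow> y \<in> S \<Longrightarrow> z \<in> S \<Longrightarrow> m (m x y) z = m x (m y z)"
    and inv: "\<And>s. s \<in> S \<Longrightarrow> is_inverse S m s (j s)"
    and comm: "\<And>e f. e \<in> S \<Longrightarrow> f \<in> S \<Longrightarrow> m e e = e \<Longrightarrow> m f f = f \<Longrightarrow> m e f = m f e"
  shows "inverse_semigroup S m" "s \<in> S \<Longrightarrow> dagger S m s = j s"
proof -
  have uniq: "t = u" if s: "s \<in> S" and t: "is_inverse S m s t" and u: "is_inverse S m s u" for s t u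
  proof -
    have tS: "t \<in> S" and uS: "u \<in> S"
      and st: "m s (m t s) = s" "m t (m s t) = t" and su: "m s (m u s) = s" "m u (m s u) = u"
      using s t u by (auto simp: is_inverse_def as)
    have c1: "m (m s t) (m s u) = m (m s u) (m s t)"
      by (rule comm) (simp_all add: s tS uS cl as st su)
    have c2: "m (m t s) (m u s) = m (m u s) (m t s)"
      by (rule comm) (simp_all add: s tS uS cl as st su)
    have e1: "m (m s t) (m s u) = m s u"
      using st(1) s tS uS by (metis as cl)
    have e2: "m (m s u) (m s t) = m s t"
      using su(1) s tS uS by (metis as cl)
    have e3: "m (m t s) (m u s) = m t s"
      using su(1) s tS uS by (metis as cl)
    have e4: "m (m u s) (m t s) = m u s"
      using st(1) s tS uS by (metis as cl)
    have eq1: "m s t = m s u" using c1 e1 e2 by simp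
    have eq2: "m t s = m u s" using c2 e3 e4 by simp
    have "t = m (m t s) t" using st(2) s tS by (simp add: as)
    also have "\<dots> = m u (m s t)" unfolding eq2 using s tS uS by (simp add: as)
    also have "\<dots> = u" unfolding eq1 by (rule su(2))
    finally show "t = u" .
  qed
  show "inverse_semigroup S m"
    unfolding inverse_semigroup_def using cl as inv uniq by blast
  show "dagger S m s = j s" if "s \<in> S"
    unfolding dagger_def by (rule the_equality) (use that inv uniq in blast)+
qed

text \<open>If \<open>h s\<close> is idempotent and \<open>x\<close> is an inverse of
  \<open>s s\<close>, then \<open>d = s x s\<close> is an idempotent with \<open>h d = h s\<close>.
  Commutation is inherited from such lifts.\<close>

lemma idempotents_commute_homomorphic_image:
  assumes cl: "\<And>x y. x \<in> S \<Longrightarrow> y \<in> S \<Longrightarrow> m x y \<in> S"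
    and as: "\<And>x y z. x \<in> S \<Longrightarrow> y \<in> S \<Longrightarrow> z \<in> S \<Longrightarrow> m (m x y) z = m x (m y z)"
    and inv: "\<And>s. s \<in> S \<Longrightarrow> is_inverse S m s (j s)"
    and comm: "\<And>e f. e \<in> S \<Longrightarrow> f \<in> S \<Longrightarrow> m e e = e \<Longrightarrow> m f f = f \<Longrightarrow> m e f = m f e"
    and hom: "\<And>x y. x \<in> S \<Longrightarrow> y \<in> S \<Longrightarrow> h (m x y) = n (h x) (h y)"
    and e: "e \<in> h ` S" "n e e = e" and f: "f \<in> h ` S" "n f f = f"
  shows "n e f = n f e"
proof -
  have lift: "\<exists>d\<in>S. m d d = d \<and> h d = h s" if s: "s \<in> S" and i: "n (h s) (h s) = h s" for s
  proof -
    define x where "x = j (m s s)"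
    have x: "x \<in> S" "m (m (m s s) x) (m s s) = m s s" "m (m x (m s s)) x = x"
      using inv[OF cl[OF s s]] by (auto simp: is_inverse_def x_def)
    define d where "d = m (m s x) s"
    have d: "d \<in> S" using s x by (simp add: d_def cl)
    have "m d d = m (m s (m (m x (m s s)) x)) s"
      using s x(1) by (simp add: d_def as cl)
    also have "\<dots> = d" by (simp add: x(3) d_def)
    finally have dd: "m d d = d" .
    have "h d = n (n (h s) (h x)) (h s)" using s x by (simp add: d_def hom cl)
    also have "\<dots> = n (n (n (h s) (h s)) (h x)) (n (h s) (h s))" by (simp add: i)
    also have "\<dots> = h (m (m (m s s) x) (m s s))" using s x(1) by (simp add: hom cl)
    also have "\<dots> = h s" using s i by (simp add: x(2) hom)
    finally show ?thesis using d dd by blast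
  qed
  obtain d where d: "d \<in> S" "m d d = d" "h d = e" using e lift by blast
  obtain d' where d': "d' \<in> S" "m d' d' = d'" "h d' = f" using f lift by blast
  show ?thesis using comm[OF d(1) d'(1) d(2) d'(2)] hom d d' by metis
qed


section \<open>Norm and exponential in the unitization\<close>

lemma scaleC_diff_right: "c *\<^sub>C (x - y) = c *\<^sub>C x - c *\<^sub>C (y::'a::complex_vector)"
  by (metis add_diff_cancel diff_add_cancel scaleC_add_right)

lemma scaleC_diff_left: "(c - d) *\<^sub>C x = c *\<^sub>C x - d *\<^sub>C (x::'a::complex_vector)"
  by (metis add_diff_cancel diff_add_cancel scaleC_add_left)

lemma scaleC_zero_right [simp]: "c *\<^sub>C 0 = (0::'a::complex_vector)"
  using scaleC_diff_right[of c 0 0] by simp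

lemma scaleC_zero_left [simp]: "0 *\<^sub>C x = (0::'a::complex_vector)"
  using scaleC_diff_left[of 0 0 x] by simp

lemma scaleC_minus_left: "(- c) *\<^sub>C x = - (c *\<^sub>C (x::'a::complex_vector))"
  using scaleC_diff_left[of 0 c x] by simp

lemma scaleC_of_real: "complex_of_real r *\<^sub>C x = r *\<^sub>R (x::'a::complex_vector)"
  by (simp add: scaleR_scaleC)

lemma tendsto_scaleC:
  "(f \<longlongrightarrow> l) F \<Longrightarrow> ((\<lambda>x. c *\<^sub>C f x) \<longlongrightarrow> c *\<^sub>C (l::'a::complex_banach)) F"
  unfolding tendsto_iff dist_norm
proof (intro allI impI)
  fix e :: real assume a: "\<forall>e>0. \<forall>\<^sub>F x in F. norm (f x - l) < e" and e: "0 < e"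
  \<comment> \<open>The summand 1 covers the case \<open>c = 0\<close>.\<close>
  have "e / (cmod c + 1) > 0" using e by (simp add: add_nonneg_pos)
  then have "\<forall>\<^sub>F x in F. norm (f x - l) < e / (cmod c + 1)" using a by blast
  then show "\<forall>\<^sub>F x in F. norm (c *\<^sub>C f x - c *\<^sub>C l) < e"
  proof eventually_elim
    case (elim x)
    have "norm (c *\<^sub>C f x - c *\<^sub>C l) = cmod c * norm (f x - l)"
      by (simp add: norm_scaleC flip: scaleC_diff_right)
    also have "\<dots> \<le> (cmod c + 1) * norm (f x - l)"
      by (simp add: mult_right_mono)
    also have "\<dots> < e" using elim by (simp add: pos_less_divide_eq add_nonneg_pos mult.commute)
    finally show ?case .
  qed
qed

text \<open>Left multiplication by \<open>a + \<mu>1\<close> on the ideal \<open>A\<close>. Stating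
  everything through this action treats the unital and the nonunital case alike.\<close>

definition act :: "'a::complex_banach_algebra \<times> complex \<Rightarrow> 'a \<Rightarrow> 'a"
  where "act x b = fst x * b + snd x *\<^sub>C b"

lemma unit_of_The: "unit_of (u::'a::complex_banach_algebra) \<Longrightarrow> (THE u::'a. unit_of u) = u"
  by (rule the_equality) (auto simp: unit_of_def, metis)

abbreviation \<U> where "\<U> \<equiv> unitization TYPE('a::complex_banach_algebra)"

lemma carrier_unitization:
  "x \<in> carrier (\<U> :: ('a::complex_banach_algebra \<times> complex) unital_alg) \<longleftrightarrow> (unital TYPE('a) \<longrightarrow> snd x = 0)"
  by (cases x) (auto simp: unitization_def)

lemma act_mult: "act (mult \<U> x y) b = act x (act y b)"
  by (cases x; cases y)
    (simp add: unitization_def act_def algebra_simps scaleC_add_right mult_scaleC_left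
      mult_scaleC_right scaleC_scaleC)

lemma act_unt [simp]: "act (unt \<U>) b = b"
proof (cases "unital TYPE('a)")
  case True
  then obtain u :: 'a where u: "unit_of u" by (auto simp: unital_def)
  then show ?thesis using True
    by (auto simp: unitization_def act_def unit_of_The) (simp add: unit_of_def)
qed (simp add: unitization_def act_def scaleC_one)

lemma act_simps [simp]:
  "act (x + y) b = act x b + act y b" "act (x - y) b = act x b - act y b" "act (a, 0) b = a * b"
  by (simp_all add: act_def algebra_simps scaleC_add_left scaleC_diff_left)

lemma unt_carrier: "unt \<U> \<in> carrier \<U>"
  by (simp add: carrier_unitization) (simp add: unitization_def)

lemma norm_act_bound: "norm (act x b) \<le> norm (fst x) + cmod (snd x)" if "norm b \<le> 1"
proof -
  have "norm (act x b) \<le> norm (fst x) * norm b + cmod (snd x) * norm b"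
    unfolding act_def using norm_triangle_ineq[of "fst x * b" "snd x *\<^sub>C b"] norm_mult_ineq[of "fst x" b]
    by (simp add: norm_scaleC)
  also have "\<dots> \<le> norm (fst x) * 1 + cmod (snd x) * 1"
    by (intro add_mono mult_left_mono that) auto
  finally show ?thesis by simp
qed

lemma bdd_above_norm_act: "bdd_above ((\<lambda>b. norm (act x b)) ` {b. norm b \<le> 1})"
  by (rule bdd_aboveI2) (rule norm_act_bound, simp)

text \<open>In both cases the norm is the operator norm of the action: for unital \<open>A\<close>,
  testing on the contractive unit recovers the norm of \<open>A\<close>; otherwise this is
  homogeneity of the supremum over the unit ball.\<close>

lemma nrm_le_iff:
  fixes x :: "'a::complex_banach_algebra \<times> complex"
  assumes x: "x \<in> carrier \<U>" and C: "C \<ge> 0"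
  shows "nrm \<U> x \<le> C \<longleftrightarrow> (\<forall>b. norm (act x b) \<le> C * norm b)"
proof (cases "unital TYPE('a)")
  case True
  then obtain u :: 'a where u: "unit_of u" by (auto simp: unital_def)
  have s: "snd x = 0" using x True by (simp add: carrier_unitization)
  have n: "nrm \<U> x = norm (fst x)" using True by (cases x) (simp add: unitization_def)
  have "norm (fst x * b) \<le> C * norm b" if "norm (fst x) \<le> C" for b
    using norm_mult_ineq[of "fst x" b] that by (meson mult_right_mono norm_ge_zero order_trans)
  moreover have "norm (fst x) \<le> C" if "\<forall>b. norm (fst x * b) \<le> C * norm b"
    using that[rule_format, of u] u C mult_left_mono[of "norm u" 1 C] by (simp add: unit_of_def)
  ultimately show ?thesis unfolding n act_def s by auto
next
  case False
  have n: "nrm \<U> x = (SUP b\<in>{b. norm b \<le> 1}. norm (act x b))"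
    using False by (cases x) (simp add: unitization_def act_def)
  have scale: "act x (r *\<^sub>R b) = r *\<^sub>R act x b" for r b
    by (simp add: act_def scaleR_right_distrib) (simp add: scaleR_scaleC scaleC_scaleC mult.commute)
  have "nrm \<U> x \<le> C \<longleftrightarrow> (\<forall>b. norm b \<le> 1 \<longrightarrow> norm (act x b) \<le> C)"
    unfolding n by (subst cSUP_le_iff[OF _ bdd_above_norm_act]) (auto intro: exI[of _ 0])
  also have "\<dots> \<longleftrightarrow> (\<forall>b. norm (act x b) \<le> C * norm b)"
  proof safe
    fix b :: 'a assume a: "\<forall>b. norm b \<le> 1 \<longrightarrow> norm (act x b) \<le> C"
    show "norm (act x b) \<le> C * norm b"
    proof (cases "b = 0")
      case True then show ?thesis by (simp add: act_def)
    next
      case False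
      then have "norm (act x ((1 / norm b) *\<^sub>R b)) \<le> C" using a by simp
      then show ?thesis unfolding scale using False by (simp add: field_simps)
    qed
  next
    fix b :: 'a assume a: "\<forall>b. norm (act x b) \<le> C * norm b" and "norm b \<le> 1"
    then show "norm (act x b) \<le> C"
      using spec[OF a, of b] mult_left_mono[of "norm b" 1 C] C by linarith
  qed
  finally show ?thesis .
qed

lemma nrm_nonneg:
  fixes x :: "'a::complex_banach_algebra \<times> complex"
  assumes x: "x \<in> carrier \<U>"
  shows "nrm \<U> x \<ge> 0"
proof (cases "unital TYPE('a)")
  case True
  then show ?thesis by (cases x) (simp add: unitization_def)
next
  case False
  then have "nrm \<U> x = (SUP b\<in>{b. norm b \<le> 1}. norm (act x b))"
    by (cases x) (simp add: unitization_def act_def)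
  then have "norm (act x 0) \<le> nrm \<U> x" by (auto intro!: cSUP_upper bdd_above_norm_act)
  then show ?thesis by (rule order_trans[OF norm_ge_zero])
qed

lemma norm_act_le: "norm (act x b) \<le> nrm \<U> x * norm b" if "x \<in> carrier \<U>"
  using nrm_le_iff[OF that nrm_nonneg[OF that]] by blast

text \<open>If \<open>\<mu>\<close> were nonzero, \<open>- a / \<mu>\<close> would be a left unit,
  hence the limit of the approximate identity, hence a contractive two-sided unit; but then the
  carrier only contains pairs with \<open>\<mu> = 0\<close>. Once \<open>\<mu> = 0\<close>, the
  approximate identity gives \<open>a = 0\<close>.\<close>

lemma act_faithful:
  fixes x :: "'a::complex_banach_algebra \<times> complex"
  assumes au: "approximately_unital TYPE('a)" and x: "x \<in> carrier \<U>" and z: "\<And>b. act x b = 0"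
  shows "x = 0"
proof -
  obtain F :: "'a filter" where F: "F \<noteq> bot" "\<forall>\<^sub>F e in F. norm e \<le> 1"
    "\<And>a. ((\<lambda>e. a * e) \<longlongrightarrow> a) F" "\<And>a. ((\<lambda>e. e * a) \<longlongrightarrow> a) F"
    using au unfolding approximately_unital_def by metis
  obtain a \<mu> where [simp]: "x = (a, \<mu>)" by (cases x)
  have \<mu>: "\<mu> = 0"
  proof (rule ccontr)
    assume "\<mu> \<noteq> 0"
    define u where "u = (- 1 / \<mu>) *\<^sub>C a"
    have ul: "u * b = b" for b
    proof -
      have "\<mu> *\<^sub>C b = - (a * b)" using z[of b] by (simp add: act_def eq_neg_iff_add_eq_0 add.commute)
      then have "(1 / \<mu>) *\<^sub>C (\<mu> *\<^sub>C b) = (1 / \<mu>) *\<^sub>C (- (a * b))" by simp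
      then show ?thesis using \<open>\<mu> \<noteq> 0\<close> scaleC_diff_right[of "1 / \<mu>" 0 "a * b"]
        by (simp add: u_def mult_scaleC_left scaleC_scaleC scaleC_one scaleC_minus_left)
    qed
    have lim: "((\<lambda>e. e) \<longlongrightarrow> u) F" using F(3)[of u] by (simp add: ul)
    have ur: "b * u = b" for b
      using tendsto_unique[OF F(1) tendsto_mult[OF tendsto_const[of b] lim] F(3)] .
    have "norm u \<le> 1"
      using tendsto_upperbound[OF tendsto_norm[OF lim] F(2,1)] .
    then have "unital TYPE('a)" unfolding unital_def unit_of_def using ul ur by blast
    then show False using x \<open>\<mu> \<noteq> 0\<close> by (simp add: carrier_unitization)
  qed
  have "a * b = 0" for b using z[of b] by (simp add: \<mu>)
  then have "a = 0" using tendsto_unique[OF F(1) F(3)[of a], of 0] by simp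
  then show ?thesis using \<mu> by (simp add: zero_prod_def)
qed

section \<open>Exponentials of multiples of an idempotent\<close>

lemma alg_power_idempotent:
  fixes e :: "'a::complex_banach_algebra"
  assumes "e * e = e"
  shows "alg_power \<U> (c *\<^sub>C (e, 0)) (Suc k) = (c ^ Suc k *\<^sub>C e, 0)"
proof (induction k)
  case 0
  show ?case
  proof (cases "unital TYPE('a)")
    case True
    then obtain u :: 'a where u: "unit_of u" by (auto simp: unital_def)
    then have "e * u = e" by (simp add: unit_of_def)
    then show ?thesis using True
      by (simp add: unitization_def unit_of_The[OF u] scaleC_prod_def mult_scaleC_left)
  qed (simp add: unitization_def scaleC_prod_def scaleC_one)
next
  case (Suc k)
  then show ?case using assms
    by (simp add: unitization_def scaleC_prod_def mult_scaleC_left mult_scaleC_right scaleC_scaleC)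
qed


lemma carrier_ideal [simp]: "(a, 0) \<in> carrier \<U>"
  by (simp add: carrier_unitization)

lemma carrier_add: "x \<in> carrier \<U> \<Longrightarrow> y \<in> carrier \<U> \<Longrightarrow> x + y \<in> carrier \<U>"
  by (simp add: carrier_unitization)

lemma carrier_diff: "x \<in> carrier \<U> \<Longrightarrow> y \<in> carrier \<U> \<Longrightarrow> x - y \<in> carrier \<U>"
  by (simp add: carrier_unitization)

text \<open>All powers of \<open>c e\<close> beyond the zeroth are multiples of \<open>e\<close>, so
  the series collapses. As \<open>alg_exp\<close> is a definite description, limits must also be
  unique, which follows from faithfulness of the action.\<close>

lemma alg_exp_idempotent:
  fixes e :: "'a::complex_banach_algebra"
  assumes au: "approximately_unital TYPE('a)" and e: "e * e = e"
  shows "alg_exp \<U> (c *\<^sub>C (e, 0)) = unt \<U> + ((exp c - 1) *\<^sub>C e, 0)"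
proof -
  define S where "S n = (\<Sum>k<n. (1 / fact k) *\<^sub>C alg_power \<U> (c *\<^sub>C (e, 0)) k)" for n
  define Y where "Y = unt \<U> + ((exp c - 1) *\<^sub>C e, 0)"
  \<comment> \<open>The zeroth power is the unit rather than a multiple of \<open>e\<close>, so the
    partial sums are shifted by one.\<close>
  have S: "S (Suc n) = unt \<U> + ((\<Sum>k<n. c ^ Suc k /\<^sub>R fact (Suc k)) *\<^sub>C e, 0)" for n
  proof (induction n)
    case 0
    then show ?case by (simp add: S_def scaleC_one zero_prod_def)
  next
    case (Suc n)
    have "S (Suc (Suc n)) = S (Suc n) + (1 / fact (Suc n)) *\<^sub>C alg_power \<U> (c *\<^sub>C (e, 0)) (Suc n)"
      by (simp add: S_def)
    also have "\<dots> = unt \<U> + ((\<Sum>k<Suc n. c ^ Suc k /\<^sub>R fact (Suc k)) *\<^sub>C e, 0)"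
      unfolding Suc alg_power_idempotent[OF e]
      by (simp add: scaleC_prod_def scaleC_scaleC scaleC_add_left scaleR_conv_of_real divide_inverse
            add.assoc mult.commute del: power_Suc fact_Suc)
    finally show ?case .
  qed
  have Sc: "S (Suc n) \<in> carrier \<U>" for n
    unfolding S by (intro carrier_add unt_carrier) simp
  have Yc: "Y \<in> carrier \<U>"
    unfolding Y_def by (intro carrier_add unt_carrier) simp
  have "(\<lambda>k. c ^ Suc k /\<^sub>R fact (Suc k)) sums (exp c - 1)"
    using exp_converges[of c] by (subst sums_Suc_iff) simp
  then have "(\<lambda>n. (\<Sum>k<n. c ^ Suc k /\<^sub>R fact (Suc k)) - (exp c - 1)) \<longlonglongrightarrow> 0"
    by (simp add: sums_def LIM_zero)
  then have lim: "(\<lambda>n. cmod ((\<Sum>k<n. c ^ Suc k /\<^sub>R fact (Suc k)) - (exp c - 1)) * norm e) \<longlonglongrightarrow> 0"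
    by (intro tendsto_mult_left_zero tendsto_norm_zero)
  have dif: "S (Suc n) - Y = (((\<Sum>k<n. c ^ Suc k /\<^sub>R fact (Suc k)) - (exp c - 1)) *\<^sub>C e, 0)" for n
    unfolding S Y_def by (simp add: scaleC_diff_left)
  have bound: "nrm \<U> (S (Suc n) - Y) \<le>
      cmod ((\<Sum>k<n. c ^ Suc k /\<^sub>R fact (Suc k)) - (exp c - 1)) * norm e" for n
    unfolding dif
    by (subst nrm_le_iff) (auto simp flip: norm_scaleC simp: norm_mult_ineq)
  have limY: "(\<lambda>n. nrm \<U> (S n - Y)) \<longlonglongrightarrow> 0"
    by (subst filterlim_sequentially_Suc[symmetric], rule tendsto_sandwich[OF _ _ tendsto_const lim])
      (intro always_eventually allI bound nrm_nonneg carrier_diff Sc Yc)+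
  have uniq: "y = Y" if yc: "y \<in> carrier \<U>" and y: "(\<lambda>n. nrm \<U> (S n - y)) \<longlonglongrightarrow> 0" for y
  proof -
    have "act (Y - y) b = 0" for b
    proof -
      have "norm (act (Y - y) b) \<le> (nrm \<U> (S (Suc n) - y) + nrm \<U> (S (Suc n) - Y)) * norm b" for n
      proof -
        have "norm (act (Y - y) b) = norm (act (S (Suc n) - y) b - act (S (Suc n) - Y) b)"
          by simp
        also have "\<dots> \<le> norm (act (S (Suc n) - y) b) + norm (act (S (Suc n) - Y) b)"
          by (rule norm_triangle_ineq4)
        also have "\<dots> \<le> nrm \<U> (S (Suc n) - y) * norm b + nrm \<U> (S (Suc n) - Y) * norm b"
          by (intro add_mono norm_act_le carrier_diff Sc Yc yc)
        finally show ?thesis by (simp add: algebra_simps)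
      qed
      moreover have "(\<lambda>n. (nrm \<U> (S (Suc n) - y) + nrm \<U> (S (Suc n) - Y)) * norm b) \<longlonglongrightarrow> (0 + 0) * norm b"
        by (intro tendsto_intros LIMSEQ_Suc[OF y] LIMSEQ_Suc[OF limY])
      ultimately have "norm (act (Y - y) b) \<le> (0 + 0) * norm b"
        by (intro tendsto_lowerbound[OF _ always_eventually]) auto
      then show ?thesis by simp
    qed
    then have "Y - y = 0" by (intro act_faithful[OF au] carrier_diff Yc yc)
    then show ?thesis by simp
  qed
  show ?thesis
    unfolding alg_exp_def S_def[symmetric] Y_def[symmetric]
    by (rule the_equality) (use Yc limY uniq in blast)+
qed

text \<open>For \<open>z = cis t\<close>, the exponential of \<open>\<i> t e\<close> is
  \<open>1 + (z - 1) e\<close>. A nonzero element must exist because the unit of the zero algebra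
  has norm 0, so that nothing is hermitian there.\<close>

lemma hermitian_idempotent_iff:
  fixes e :: "'a::complex_banach_algebra"
  assumes au: "approximately_unital TYPE('a)"
  shows "hermitian_idempotent e \<longleftrightarrow> e * e = e \<and> (\<exists>b::'a. b \<noteq> 0) \<and>
    (\<forall>z b. cmod z = 1 \<longrightarrow> norm (b + (z - 1) *\<^sub>C (e * b)) \<le> norm b)"
proof (cases "e * e = e")
  case e: True
  define X where "X z = unt \<U> + ((z - 1) *\<^sub>C e, 0)" for z
  have Xc: "X z \<in> carrier \<U>" for z
    unfolding X_def by (intro carrier_add unt_carrier) simp
  have actX: "act (X z) b = b + (z - 1) *\<^sub>C (e * b)" for z b
    unfolding X_def by (simp add: mult_scaleC_left)
  have le1: "nrm \<U> (X z) \<le> 1 \<longleftrightarrow> (\<forall>b. norm (b + (z - 1) *\<^sub>C (e * b)) \<le> norm b)" for z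
    by (subst nrm_le_iff[OF Xc]) (simp_all add: actX)
  have h: "hermitian_idempotent e \<longleftrightarrow> (\<forall>t. nrm \<U> (X (cis t)) = 1)"
  proof -
    show ?thesis
      using alg_exp_idempotent[OF au e, of "\<i> * complex_of_real _"]
      by (simp add: hermitian_idempotent_def hermitian_def hermitian_in_def e X_def cis_conv_exp)
  qed
  \<comment> \<open>The inverse of \<open>1 + (z - 1) e\<close> is \<open>1 + (cnj z - 1) e\<close>.
    It is contractive too, so the norm is at least 1.\<close>
  have eq1: "nrm \<U> (X z) = 1" if z: "cmod z = 1" and nz: "b0 \<noteq> 0"
    and c: "\<And>z b. cmod z = 1 \<Longrightarrow> norm (b + (z - 1) *\<^sub>C (e * b)) \<le> norm b" for z and b0 :: 'a
  proof (rule antisym)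
    show "nrm \<U> (X z) \<le> 1" unfolding le1 using z c by blast
    have zc: "cnj z * z = 1" using z by (metis complex_norm_square mult.commute of_real_1 power_one)
    define b1 where "b1 = act (X (cnj z)) b0"
    have "act (X z) b1 = b0 + ((z - 1) + (cnj z - 1) + (z - 1) * (cnj z - 1)) *\<^sub>C (e * b0)"
      unfolding b1_def actX
      by (simp add: algebra_simps scaleC_add_left mult_scaleC_right scaleC_add_right scaleC_scaleC
          scaleC_diff_left scaleC_diff_right e flip: mult.assoc)
    also have "(z - 1) + (cnj z - 1) + (z - 1) * (cnj z - 1) = 0"
      using zc by (simp add: algebra_simps)
    finally have "norm b0 \<le> nrm \<U> (X z) * norm b1"
      using norm_act_le[OF Xc, of z b1] by simp
    also have "\<dots> \<le> nrm \<U> (X z) * norm b0"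
      using c[of "cnj z" b0] z by (intro mult_left_mono nrm_nonneg Xc) (simp add: b1_def actX)
    finally show "1 \<le> nrm \<U> (X z)" using nz by simp
  qed
  have nz: "\<exists>b::'a. b \<noteq> 0" if "nrm \<U> (X 1) = 1"
  proof (rule ccontr)
    assume "\<not> (\<exists>b::'a. b \<noteq> 0)"
    then have "nrm \<U> (X 1) \<le> 0" by (subst nrm_le_iff[OF Xc]) auto
    then show False using that by simp
  qed
  show ?thesis
  proof
    assume a: "hermitian_idempotent e"
    have "norm (b + (z - 1) *\<^sub>C (e * b)) \<le> norm b" if "cmod z = 1" for z b
    proof -
      have "z = cis (Arg z)" using that by (metis cis_Arg norm_zero sgn_eq zero_neq_one div_by_1
          of_real_1)
      then have "nrm \<U> (X z) = 1" using a h by metis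
      then show ?thesis using le1[of z] by simp
    qed
    moreover have "nrm \<U> (X 1) = 1" using a h by (metis cis_zero)
    ultimately show "e * e = e \<and> (\<exists>b::'a. b \<noteq> 0) \<and>
        (\<forall>z b. cmod z = 1 \<longrightarrow> norm (b + (z - 1) *\<^sub>C (e * b)) \<le> norm b)"
      using e nz by blast
  next
    assume "e * e = e \<and> (\<exists>b::'a. b \<noteq> 0) \<and>
        (\<forall>z b. cmod z = 1 \<longrightarrow> norm (b + (z - 1) *\<^sub>C (e * b)) \<le> norm b)"
    then show "hermitian_idempotent e" unfolding h using eq1 by auto
  qed
qed (simp add: hermitian_idempotent_def)

lemma mult_carrier: "x \<in> carrier \<U> \<Longrightarrow> y \<in> carrier \<U> \<Longrightarrow> mult \<U> x y \<in> carrier \<U>"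
  by (cases x; cases y) (auto simp: carrier_unitization unitization_def)

text \<open>The last expression is the action of \<open>e x e + (1 - e) y (1 - e)\<close> on
  \<open>b\<close>, so the condition is expressed by the norm of \<open>A\<close> alone.\<close>

lemma ultrahermitian_iff:
  fixes e :: "'a::complex_banach_algebra"
  assumes e: "e * e = e"
  shows "ultrahermitian e \<longleftrightarrow>
    (\<forall>x\<in>carrier \<U>. \<forall>y\<in>carrier \<U>. (\<forall>b. norm (act x b) \<le> norm b) \<longrightarrow> (\<forall>b. norm (act y b) \<le> norm b) \<longrightarrow>
      (\<forall>b. norm (e * act x (e * b) + (act y (b - e * b) - e * act y (b - e * b))) \<le> norm b))"
proof -
  have e2: "mult \<U> (e, 0) (e, 0) = (e, 0)"
    by (simp add: unitization_def e)
  have le1: "nrm \<U> x \<le> 1 \<longleftrightarrow> (\<forall>b. norm (act x b) \<le> norm b)" if "x \<in> carrier \<U>" for x :: "'a \<times> complex"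
    using nrm_le_iff[OF that, of 1] by simp
  show ?thesis
    unfolding ultrahermitian_def ultrahermitian_in_def
    by (auto simp: e2 le1 mult_carrier carrier_add carrier_diff unt_carrier act_mult)
qed

section \<open>Moore-Penrose inverses\<close>

lemma is_mp_inverse_hermitian_idempotent:
  assumes "is_mp_inverse a b"
  shows "hermitian_idempotent (a * b)" "hermitian_idempotent (b * a)"
proof -
  have "a * b * a = a" "b * a * b = b" and h: "hermitian (a * b)" "hermitian (b * a)"
    using assms unfolding is_mp_inverse_def by auto
  then have "a * b * (a * b) = a * b" "b * a * (b * a) = b * a"
    by (simp_all flip: mult.assoc)
  then show "hermitian_idempotent (a * b)" "hermitian_idempotent (b * a)"
    using h by (simp_all add: hermitian_idempotent_def)
qed

lemma is_mp_inverse_sym: "is_mp_inverse a b \<Longrightarrow> is_mp_inverse b a"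
  by (simp add: is_mp_inverse_def)


section \<open>MP-partial isometries and their homotopy classes\<close>

context
  assumes au: "approximately_unital TYPE('a::complex_banach_algebra)"
    and uh: "hermitian_idempotents_ultrahermitian_and_commute TYPE('a)"
begin

lemma hermitian_idempotents_commute:
  "hermitian_idempotent (e::'a) \<Longrightarrow> hermitian_idempotent f \<Longrightarrow> e * f = f * e"
  using uh by (simp add: hermitian_idempotents_ultrahermitian_and_commute_def)

text \<open>\<open>a b\<close> and \<open>a c\<close> are commuting idempotents whose products in
  the two orders are \<open>a c\<close> and \<open>a b\<close>, so they agree; likewise
  \<open>b a = c a\<close>. Then \<open>b = b a b = b a c = c a c = c\<close>.\<close>

lemma is_mp_inverse_unique:
  fixes a :: 'a
  assumes b: "is_mp_inverse a b" and c: "is_mp_inverse a c"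
  shows "b = c"
proof -
  note b' = is_mp_inverse_hermitian_idempotent[OF b] and c' = is_mp_inverse_hermitian_idempotent[OF c]
  have ab: "a * b * a = a" "b * a * b = b" and ac: "a * c * a = a" "c * a * c = c"
    using b c by (auto simp: is_mp_inverse_def)
  have "a * b = a * c"
    using hermitian_idempotents_commute[OF b'(1) c'(1)] ab(1) ac(1) by (metis mult.assoc)
  moreover have "b * a = c * a"
    using hermitian_idempotents_commute[OF b'(2) c'(2)] ab(1) ac(1) by (metis mult.assoc)
  ultimately show ?thesis using ab(2) ac(2) by (metis mult.assoc)
qed

lemma mp_inverse_eq: "is_mp_inverse (a::'a) b \<Longrightarrow> mp_inverse a = b"
  unfolding mp_inverse_def by (rule the_equality) (use is_mp_inverse_unique in blast)+

lemma PI_MP_D: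
  assumes "(a::'a) \<in> PI_MP"
  shows "is_mp_inverse a (mp_inverse a)" "norm a \<le> 1" "norm (mp_inverse a) \<le> 1"
proof -
  obtain b where "is_mp_inverse a b" using assms by (auto simp: PI_MP_def mp_invertible_def)
  then show "is_mp_inverse a (mp_inverse a)" using mp_inverse_eq by blast
  show "norm a \<le> 1" "norm (mp_inverse a) \<le> 1" using assms by (auto simp: PI_MP_def)
qed

lemma PI_MP_I: "is_mp_inverse (a::'a) b \<Longrightarrow> norm a \<le> 1 \<Longrightarrow> norm b \<le> 1 \<Longrightarrow> a \<in> PI_MP"
  unfolding PI_MP_def mp_invertible_def using mp_inverse_eq[of a b] by auto

text \<open>Conjugating \<open>exp (\<i> t f) = 1 + (z - 1) f\<close> by \<open>a\<close> gives a contraction on the corner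
  cut out by \<open>a b\<close>, which stays contractive after adding \<open>1 - a b\<close> because \<open>a b\<close> is ultrahermitian.\<close>

lemma hermitian_idempotent_conjugate:
  fixes a :: 'a
  assumes ab: "is_mp_inverse a b" "norm a \<le> 1" "norm b \<le> 1" and f: "hermitian_idempotent f"
  shows "hermitian_idempotent (a * f * b)"
proof -
  have a1: "a * b * a = a" and b1: "b * a * b = b" using ab by (auto simp: is_mp_inverse_def)
  note ab' = is_mp_inverse_hermitian_idempotent[OF ab(1)]
  have fn: "norm (c + (z - 1) *\<^sub>C (f * c)) \<le> norm c" if "cmod z = 1" for z c
    using f that unfolding hermitian_idempotent_iff[OF au] by auto
  have f2: "f * f = f" using f by (simp add: hermitian_idempotent_def)
  have com: "f * (b * a) = b * a * f" using hermitian_idempotents_commute[OF f ab'(2)] by simp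
  have idem: "(a * f * b) * (a * f * b) = a * f * b"
  proof -
    have "(a * f * b) * (a * f * b) = a * (f * (b * a)) * (f * b)" by (simp add: mult.assoc)
    also have "\<dots> = (a * b * a) * (f * f) * b" unfolding com by (simp add: mult.assoc)
    finally show ?thesis by (simp add: a1 f2)
  qed
  have e2: "(a * b) * (a * b) = a * b" using ab'(1) by (simp add: hermitian_idempotent_def)
  have uab: "ultrahermitian (a * b)"
    using uh ab'(1) by (simp add: hermitian_idempotents_ultrahermitian_and_commute_def)
  have "norm (c + (z - 1) *\<^sub>C ((a * f * b) * c)) \<le> norm c" if z: "cmod z = 1" for z c
  proof -
    \<comment> \<open>This is \<open>a (1 + (z - 1) f) b\<close>, a product of three contractions,
      written inside \<open>A\<close>.\<close>
    define x where "x = a * b + (z - 1) *\<^sub>C (a * f * b)"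
    have "norm (act (x, 0) d) \<le> norm d" for d
    proof -
      have "act (x, 0) d = a * (b * d + (z - 1) *\<^sub>C (f * (b * d)))"
        by (simp add: x_def algebra_simps mult_scaleC_left mult_scaleC_right)
      also have "norm \<dots> \<le> norm a * norm (b * d + (z - 1) *\<^sub>C (f * (b * d)))" by (rule norm_mult_ineq)
      also have "\<dots> \<le> 1 * norm (b * d)"
        using ab(2) fn[OF z, of "b * d"] by (intro mult_mono) auto
      also have "\<dots> \<le> norm b * norm d" by (simp add: norm_mult_ineq)
      also have "\<dots> \<le> norm d" using ab(3) by (simp add: mult_left_le_one_le)
      finally show ?thesis .
    qed
    then have "norm (a * b * act (x, 0) (a * b * c) + (act (unt \<U>) (c - a * b * c)
        - a * b * act (unt \<U>) (c - a * b * c))) \<le> norm c"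
      using uab[unfolded ultrahermitian_iff[OF e2], rule_format, of "(x, 0)" "unt \<U>"]
      by (simp add: unt_carrier)
    moreover have "a * b * act (x, 0) (a * b * c) = a * b * c + (z - 1) *\<^sub>C (a * f * b * c)"
    proof -
      have "a * b * x * (a * b) = x"
      proof -
        have 1: "a * b * (a * f * b) = a * f * b" using a1 by (metis mult.assoc)
        have 2: "a * f * b * (a * b) = a * f * b" using b1 by (metis mult.assoc)
        show ?thesis
          unfolding x_def by (simp add: distrib_left distrib_right mult_scaleC_left
              mult_scaleC_right e2 1 2)
      qed
      then have "a * b * act (x, 0) (a * b * c) = x * c" by (metis act_simps(3) mult.assoc)
      then show ?thesis by (simp add: x_def distrib_right mult_scaleC_left)
    qed
    moreover have "a * b * (c - a * b * c) = 0"
      using e2 by (simp add: right_diff_distrib) (metis mult.assoc)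
    ultimately show ?thesis by (simp add: algebra_simps)
  qed
  then show ?thesis
    unfolding hermitian_idempotent_iff[OF au] using idem f hermitian_idempotent_iff[OF au, of f] by blast
qed

text \<open>The algebraic identities come from commuting \<open>b a\<close> with \<open>c d\<close>.
  The products \<open>a (c d) b\<close> and \<open>d (b a) c\<close> are conjugates of hermitian
  idempotents, hence hermitian.\<close>

lemma is_mp_inverse_mult:
  fixes a c :: 'a
  assumes ab: "is_mp_inverse a b" "norm a \<le> 1" "norm b \<le> 1"
    and cd: "is_mp_inverse c d" "norm c \<le> 1" "norm d \<le> 1"
  shows "is_mp_inverse (a * c) (d * b)"
proof -
  have a1: "a * b * a = a" "b * a * b = b" and c1: "c * d * c = c" "d * c * d = d"
    using ab cd by (auto simp: is_mp_inverse_def)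
  note ab' = is_mp_inverse_hermitian_idempotent[OF ab(1)] and cd'
      = is_mp_inverse_hermitian_idempotent[OF cd(1)]
  have com: "b * a * (c * d) = c * d * (b * a)"
    by (rule hermitian_idempotents_commute[OF ab'(2) cd'(1)])
  have "a * c * (d * b) * (a * c) = a * ((c * d) * (b * a)) * c" by (simp add: mult.assoc)
  also have "\<dots> = a * b * a * (c * d * c)" unfolding com[symmetric] by (simp add: mult.assoc)
  finally have 1: "a * c * (d * b) * (a * c) = a * c" by (simp add: a1 c1)
  have "d * b * (a * c) * (d * b) = d * (b * a * (c * d)) * b" by (simp add: mult.assoc)
  also have "\<dots> = d * c * d * (b * a * b)" unfolding com by (simp add: mult.assoc)
  finally have 2: "d * b * (a * c) * (d * b) = d * b" by (simp add: a1 c1)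
  have 3: "hermitian (a * c * (d * b))"
    using hermitian_idempotent_conjugate[OF ab cd'(1)] by (simp add: hermitian_idempotent_def mult.assoc)
  have 4: "hermitian (d * b * (a * c))"
    using hermitian_idempotent_conjugate[OF is_mp_inverse_sym[OF cd(1)] cd(3,2) ab'(2)]
    by (simp add: hermitian_idempotent_def mult.assoc)
  show ?thesis unfolding is_mp_inverse_def using 1 2 3 4 by simp
qed

lemma PI_MP_mult:
  assumes "(a::'a) \<in> PI_MP" "c \<in> PI_MP"
  shows "a * c \<in> PI_MP"
proof -
  note a = PI_MP_D[OF assms(1)] and c = PI_MP_D[OF assms(2)]
  have "norm (a * c) \<le> 1" "norm (mp_inverse c * mp_inverse a) \<le> 1"
    by (rule order_trans[OF norm_mult_ineq mult_le_one]; rule a c norm_ge_zero)+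
  then show ?thesis
    using PI_MP_I[OF is_mp_inverse_mult[OF a c]] by blast
qed

lemma mp_inverse_in_PI_MP: "(a::'a) \<in> PI_MP \<Longrightarrow> mp_inverse a \<in> PI_MP"
  by (rule PI_MP_I[OF is_mp_inverse_sym]) (rule PI_MP_D; assumption)+

lemma is_inverse_mp_inverse: "(a::'a) \<in> PI_MP \<Longrightarrow> is_inverse PI_MP (*) a (mp_inverse a)"
  using PI_MP_D(1)[of a] mp_inverse_in_PI_MP[of a] unfolding is_inverse_def is_mp_inverse_def by blast

text \<open>An idempotent is its own Moore-Penrose inverse: commuting the factors of
  \<open>d = (d e)(e d)\<close> gives \<open>e d e = d\<close>, so \<open>e = d\<close>, and
  \<open>e = e d\<close> is hermitian.\<close>

lemma hermitian_idempotent_PI_MP: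
  assumes e: "(e::'a) \<in> PI_MP" "e * e = e"
  shows "hermitian_idempotent e"
proof -
  define d where "d = mp_inverse e"
  have mp: "is_mp_inverse e d" unfolding d_def using PI_MP_D[OF e(1)] by simp
  have ed: "e * d * e = e" "d * e * d = d" using mp by (auto simp: is_mp_inverse_def)
  note h = is_mp_inverse_hermitian_idempotent[OF mp]
  have com: "(e * d) * (d * e) = (d * e) * (e * d)" by (rule hermitian_idempotents_commute[OF h])
  have d: "d = (d * e) * (e * d)" using ed(2) e(2) by (metis mult.assoc)
  have "e * d * e = e * ((d * e) * (e * d)) * e" by (simp only: d[symmetric])
  also have "\<dots> = e * ((e * d) * (d * e)) * e" by (simp only: com)
  also have "\<dots> = (e * d) * (d * e)" using e(2) by (metis mult.assoc)
  also have "\<dots> = d" by (simp only: com d[symmetric])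
  finally have "e = d" using ed(1) by simp
  then show ?thesis using h(1) e(2) by simp
qed

section \<open>Homotopy classes\<close>

lemma homotopic_mult:
  assumes "homotopic (a::'a) a'" "homotopic b b'"
  shows "homotopic (a * b) (a' * b')"
proof -
  obtain g h where g: "path g" "path_image g \<subseteq> PI_MP" "pathstart g = a" "pathfinish g = a'"
    and h: "path h" "path_image h \<subseteq> PI_MP" "pathstart h = b" "pathfinish h = b'"
    using assms unfolding homotopic_def path_component_def by blast
  have "path (\<lambda>t. g t * h t)" using g(1) h(1) unfolding path_def by (intro continuous_intros)
  moreover have "path_image (\<lambda>t. g t * h t) \<subseteq> PI_MP"
    using g(2) h(2) unfolding path_image_def by (auto intro!: PI_MP_mult)
  ultimately show ?thesis
    unfolding homotopic_def path_component_def using g h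
    by (intro exI[of _ "\<lambda>t. g t * h t"]) (auto simp: pathstart_def pathfinish_def)
qed

lemma pi_class_eq_iff: "a \<in> PI_MP \<Longrightarrow> b \<in> PI_MP \<Longrightarrow> pi_class a = pi_class (b::'a) \<longleftrightarrow> homotopic a b"
  unfolding pi_class_def using eq_equiv_class_iff[OF equiv_homotopy_rel] by (auto simp: homotopy_rel_def)

text \<open>The definite description in \<open>S_pi_mult\<close> has a unique solution because
  products of homotopic elements are homotopic.\<close>

lemma S_pi_mult_pi_class:
  assumes a: "(a::'a) \<in> PI_MP" and b: "b \<in> PI_MP"
  shows "S_pi_mult (pi_class a) (pi_class b) = pi_class (a * b)"
  unfolding S_pi_mult_def
proof (rule the_equality)
  have "x \<in> pi_class x" if "x \<in> PI_MP" for x :: 'a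
    unfolding pi_class_def by (rule equiv_class_self[OF equiv_homotopy_rel that])
  then show "\<exists>x\<in>pi_class a. \<exists>y\<in>pi_class b. pi_class (a * b) = pi_class (x * y)"
    using a b by blast
  fix Z assume "\<exists>x\<in>pi_class a. \<exists>y\<in>pi_class b. Z = pi_class (x * y)"
  then obtain x y where xy: "homotopic a x" "homotopic b y" "Z = pi_class (x * y)"
    by (auto simp: pi_class_def homotopy_rel_def)
  then have "homotopic (a * b) (x * y)" by (intro homotopic_mult)
  moreover have "x \<in> PI_MP" "y \<in> PI_MP"
    using xy unfolding homotopic_def by (auto dest: path_component_mem)
  ultimately show "Z = pi_class (a * b)"
    using pi_class_eq_iff[OF PI_MP_mult[OF a b] PI_MP_mult[of x y]] xy(3) by simp
qed

lemma S_pi_image: "S_pi = pi_class ` (PI_MP :: 'a set)"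
  by (auto simp: S_pi_def pi_class_def quotient_def)

lemma PI_MP_idempotents_commute:
  "(e::'a) \<in> PI_MP \<Longrightarrow> f \<in> PI_MP \<Longrightarrow> e * e = e \<Longrightarrow> f * f = f \<Longrightarrow> e * f = f * e"
  by (intro hermitian_idempotents_commute hermitian_idempotent_PI_MP)

lemma inverse_semigroup_PI_MP:
  "inverse_semigroup (PI_MP :: 'a set) (*)" "(a::'a) \<in> PI_MP \<Longrightarrow> dagger PI_MP (*) a = mp_inverse a"
  by (rule inverse_semigroupI[where j = mp_inverse];
      simp add: PI_MP_mult is_inverse_mp_inverse PI_MP_idempotents_commute mult.assoc)+

lemma inverse_semigroup_S_pi:
  "inverse_semigroup (S_pi :: 'a set set) S_pi_mult"
  "(a::'a) \<in> PI_MP \<Longrightarrow> dagger S_pi S_pi_mult (pi_class a) = pi_class (mp_inverse a)"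
proof -
  \<comment> \<open>The criterion for inverse semigroups asks for a function on classes, so a
    representative is chosen. The choice disappears at the end, when inverses are known to be
    unique.\<close>
  define j where "j X = pi_class (mp_inverse (SOME a::'a. a \<in> PI_MP \<and> X = pi_class a))" for X
  have inv: "is_inverse S_pi S_pi_mult (pi_class a) (pi_class (mp_inverse a))" if "a \<in> PI_MP" for a :: 'a
    using is_inverse_mp_inverse[OF that] that mp_inverse_in_PI_MP[OF that]
    by (simp add: is_inverse_def S_pi_image S_pi_mult_pi_class PI_MP_mult)
  have j: "is_inverse S_pi S_pi_mult X (j X)" if "X \<in> S_pi" for X
  proof -
    have "\<exists>a. a \<in> PI_MP \<and> X = pi_class a" using that by (auto simp: S_pi_image)
    then have "(SOME a. a \<in> PI_MP \<and> X = pi_class a) \<in> PI_MP \<and>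
        X = pi_class (SOME a. a \<in> PI_MP \<and> X = pi_class a)" by (rule someI_ex)
    then show ?thesis unfolding j_def using inv by metis
  qed
  have comm: "S_pi_mult e f = S_pi_mult f e"
    if "e \<in> S_pi" "f \<in> S_pi" "S_pi_mult e e = e" "S_pi_mult f f = f" for e f :: "'a set"
    by (rule idempotents_commute_homomorphic_image[where S = "PI_MP :: 'a set" and m = "(*)"
          and h = pi_class and j = mp_inverse])
      (use that in \<open>auto simp: PI_MP_mult is_inverse_mp_inverse PI_MP_idempotents_commute
          mult.assoc S_pi_mult_pi_class S_pi_image\<close>)
  have cl: "S_pi_mult x y \<in> S_pi" if "x \<in> S_pi" "y \<in> S_pi" for x y :: "'a set"
    using that by (auto simp: S_pi_image S_pi_mult_pi_class PI_MP_mult)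
  have as: "S_pi_mult (S_pi_mult x y) z = S_pi_mult x (S_pi_mult y z)"
    if "x \<in> S_pi" "y \<in> S_pi" "z \<in> S_pi" for x y z :: "'a set"
    using that by (auto simp: S_pi_image S_pi_mult_pi_class PI_MP_mult mult.assoc)
  show i: "inverse_semigroup (S_pi :: 'a set set) S_pi_mult"
    by (rule inverse_semigroupI(1)[where j = j]) (use cl as j comm in auto)
  show "dagger S_pi S_pi_mult (pi_class a) = pi_class (mp_inverse a)" if a: "a \<in> PI_MP"
  proof -
    have "\<exists>!t. is_inverse S_pi S_pi_mult (pi_class a) t"
      using i a by (auto simp: inverse_semigroup_def S_pi_image)
    then show ?thesis unfolding dagger_def using inv[OF a] by (rule the1_equality)
  qed
qed

lemma inverse_semigroup_hom_pi_class:
  "inverse_semigroup_hom (PI_MP :: 'a set) (*) S_pi S_pi_mult pi_class"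
  unfolding inverse_semigroup_hom_def
  using inverse_semigroup_PI_MP inverse_semigroup_S_pi
  by (auto simp: S_pi_mult_pi_class S_pi_image)

end


section \<open>Pointwise inequalities for powers of the modulus\<close>

text \<open>By Rolle's theorem, equality would make the derivative vanish at some \<open>t\<close>
  strictly between \<open>x\<close> and \<open>y\<close>. As \<open>r \<noteq> 1\<close>, this
  forces \<open>c + t = c - t\<close>, although \<open>t > 0\<close>.\<close>

lemma powr_sum_diff_inj:
  fixes r c x y :: real
  assumes r: "r > 0" "r \<noteq> 1" and x: "0 \<le> x" "x < y" "y \<le> c"
  shows "(c + x) powr r + (c - x) powr r \<noteq> (c + y) powr r + (c - y) powr r"
proof
  assume eq: "(c + x) powr r + (c - x) powr r = (c + y) powr r + (c - y) powr r"
  have D: "((\<lambda>t. (c + t) powr r + (c - t) powr r) has_real_derivative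
      r * (c + t) powr (r - 1) - r * (c - t) powr (r - 1)) (at t)" if "x < t" "t < y" for t
    using that x by (auto intro!: derivative_eq_intros)
  have "continuous_on {x..y} (\<lambda>t. (c + t) powr r + (c - t) powr r)"
    by (intro continuous_intros continuous_on_powr') (use x r in auto)
  then have "\<exists>t>x. t < y \<and> ((\<lambda>t. (c + t) powr r + (c - t) powr r) has_real_derivative 0) (at t)"
    by (rule Rolle[OF x(2) eq]) (use D in \<open>auto simp: real_differentiable_def\<close>)
  then obtain t where t: "x < t" "t < y"
    "((\<lambda>t. (c + t) powr r + (c - t) powr r) has_real_derivative 0) (at t)" by blast
  have "r * (c + t) powr (r - 1) = r * (c - t) powr (r - 1)"
    using DERIV_unique[OF t(3) D] t by simp
  then have "(c + t) powr (r - 1) = (c - t) powr (r - 1)" using r by simp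
  then have "(r - 1) * ln (c + t) = (r - 1) * ln (c - t)"
    using t x by (simp add: powr_def)
  then have "c + t = c - t" using r t x by simp
  then show False using t x by simp
qed

text \<open>The squared moduli of \<open>a + u b\<close> and \<open>a - u b\<close> are
  \<open>c + k\<close> and \<open>c - k\<close>, where \<open>k = 2 Re (cnj a u b)\<close> and
  \<open>c\<close> is the same for all unimodular \<open>u\<close>. Since
  \<open>p / 2 \<noteq> 1\<close>, the sum of powers determines \<open>|k|\<close>.\<close>

lemma powr_norm_add_diff_eq_imp:
  fixes a b z w :: complex
  assumes p: "p > 0" "p \<noteq> 2" and n: "cmod z = 1" "cmod w = 1"
    and eq: "cmod (a + z * b) powr p + cmod (a - z * b) powr p
           = cmod (a + w * b) powr p + cmod (a - w * b) powr p"
  shows "\<bar>Re (cnj a * (z * b))\<bar> = \<bar>Re (cnj a * (w * b))\<bar>"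
proof -
  define c where "c = (cmod a)\<^sup>2 + (cmod b)\<^sup>2"
  define X where "X u = 2 * \<bar>Re (cnj a * (u * b))\<bar>" for u
  have even: "(c + 2 * k) powr r + (c - 2 * k) powr r = (c + 2 * \<bar>k\<bar>) powr r + (c - 2 * \<bar>k\<bar>) powr r"
    for k r :: real by (cases "k \<ge> 0") simp_all
  have sum: "cmod (a + u * b) powr p + cmod (a - u * b) powr p = (c + X u) powr (p / 2) + (c
      - X u) powr (p / 2)"
    and X: "0 \<le> X u" "X u \<le> c" if u: "cmod u = 1" for u
  proof -
    have pw: "cmod v powr p = ((cmod v)\<^sup>2) powr (p / 2)" for v
      by (cases "v = 0") (simp_all add: powr_powr flip: powr_numeral)
    have sq: "(cmod (a + u * b))\<^sup>2 = c + 2 * Re (cnj a * (u * b))"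
             "(cmod (a - u * b))\<^sup>2 = c - 2 * Re (cnj a * (u * b))"
    proof -
      have "(cmod (u * b))\<^sup>2 = (cmod b)\<^sup>2" using u by (simp add: norm_mult)
      moreover have "(cmod (a + v))\<^sup>2 = (cmod a)\<^sup>2 + (cmod v)\<^sup>2 + 2 * Re (cnj a * v)"
        "(cmod (a - v))\<^sup>2 = (cmod a)\<^sup>2 + (cmod v)\<^sup>2 - 2 * Re (cnj a * v)" for v
        unfolding cmod_power2 by (simp_all add: power2_eq_square algebra_simps)
      ultimately show "(cmod (a + u * b))\<^sup>2 = c + 2 * Re (cnj a * (u * b))"
             "(cmod (a - u * b))\<^sup>2 = c - 2 * Re (cnj a * (u * b))" by (simp_all add: c_def)
    qed
    show "cmod (a + u * b) powr p + cmod (a - u * b) powr p = (c + X u) powr (p / 2) + (c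
        - X u) powr (p / 2)"
      unfolding pw sq X_def by (rule even)
    show "0 \<le> X u" by (simp add: X_def)
    show "X u \<le> c"
      using zero_le_power2[of "cmod (a + u * b)"] zero_le_power2[of "cmod (a - u * b)"]
      unfolding sq X_def by linarith
  qed
  have r: "p / 2 > 0" "p / 2 \<noteq> 1" using p by auto
  have "X z = X w"
    using powr_sum_diff_inj[OF r, of "X z" "X w" c] powr_sum_diff_inj[OF r, of "X w" "X z" c]
      X[OF n(1)] X[OF n(2)] eq unfolding sum[OF n(1)] sum[OF n(2)] by linarith
  then show ?thesis by (simp add: X_def)
qed

text \<open>Let \<open>cnj a b = u + \<i> v\<close>. The rotation by \<open>\<i>\<close> gives
  \<open>|u| = |v|\<close>, the rotation by \<open>(3 + 4 \<i>) / 5\<close> gives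
  \<open>5 |u| = |3 u - 4 v|\<close>, and together they leave only zero. The second rotation is a
  unimodular number with rational coordinates, so linear arithmetic concludes.\<close>

lemma powr_norm_rotations_eq_imp:
  fixes a b :: complex
  assumes p: "p > 0" "p \<noteq> 2"
    and eq: "\<And>w. w \<in> {\<i>, Complex (3/5) (4/5)} \<Longrightarrow> cmod (a + b) powr p + cmod (a - b) powr p
           = cmod (a + w * b) powr p + cmod (a - w * b) powr p"
  shows "a * b = 0"
proof -
  define u v where "u = Re (cnj a * b)" and "v = Im (cnj a * b)"
  have "\<bar>Re (cnj a * (1 * b))\<bar> = \<bar>Re (cnj a * (\<i> * b))\<bar>"
    by (rule powr_norm_add_diff_eq_imp[OF p]) (use eq in auto)
  then have 1: "\<bar>u\<bar> = \<bar>v\<bar>" by (simp add: u_def v_def algebra_simps)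
  have "\<bar>Re (cnj a * (1 * b))\<bar> = \<bar>Re (cnj a * (Complex (3/5) (4/5) * b))\<bar>"
    by (rule powr_norm_add_diff_eq_imp[OF p]) (use eq in \<open>auto simp: complex_norm power2_eq_square\<close>)
  then have 2: "\<bar>u\<bar> = \<bar>3 / 5 * u - 4 / 5 * v\<bar>" by (simp add: u_def v_def algebra_simps)
  have "u = 0 \<and> v = 0" using 1 2 by linarith
  then have "cnj a * b = 0" by (simp add: u_def v_def complex_eq_iff)
  then show ?thesis by simp
qed

text \<open>The derivative at \<open>s = 0\<close> of \<open>\<bar>a + s b\<bar>\<^sup>p\<close>. For \<open>p = 1\<close> and \<open>a = 0\<close> this derivative does
  not exist, but the symmetric difference quotient still converges to the value \<open>0\<close>, since
  \<^term>\<open>0 powr x = 0\<close>.\<close>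

definition pderiv_at :: "real \<Rightarrow> complex \<Rightarrow> complex \<Rightarrow> real" where
  "pderiv_at p a b = p * cmod a powr (p - 2) * Re (cnj a * b)"

lemma pderiv_at_self: "pderiv_at p a a = p * cmod a powr p"
proof (cases "a = 0")
  case False
  have "Re (cnj a * a) = cmod a powr 2"
    using cmod_power2[of a] by (simp add: power2_eq_square powr_numeral)
  then show ?thesis unfolding pderiv_at_def mult.assoc by (simp del: powr_numeral flip: powr_add)
qed (simp add: pderiv_at_def)

lemma pderiv_at_add: "pderiv_at p a (b + c) = pderiv_at p a b + pderiv_at p a c"
  by (simp add: pderiv_at_def algebra_simps)

text \<open>For nonzero \<open>a\<close> this is the chain rule through the squared modulus. For
  \<open>a = 0\<close> the function is a multiple of \<open>|s| powr p\<close>, whose derivative at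
  0 is 0 when \<open>p > 1\<close>.\<close>

lemma has_real_derivative_powr_norm:
  assumes "a \<noteq> 0 \<or> p > 1"
  shows "((\<lambda>s. cmod (a + of_real s * b) powr p) has_real_derivative pderiv_at p a b) (at 0)"
proof (cases "a = 0")
  case False
  have "((\<lambda>s. ((Re a + s * Re b)\<^sup>2 + (Im a + s * Im b)\<^sup>2) powr (p / 2)) has_real_derivative
      p / 2 * ((cmod a)\<^sup>2) powr (p / 2 - 1) * (2 * Re (cnj a * b))) (at 0)"
    by (rule derivative_eq_intros refl | use False in \<open>simp add: cmod_power2 complex_neq_0\<close>)+
  moreover have "((Re a + s * Re b)\<^sup>2 + (Im a + s * Im b)\<^sup>2) powr (p / 2) = cmod (a
      + of_real s * b) powr p" for s
  proof -
    have pw: "cmod v powr p = ((cmod v)\<^sup>2) powr (p / 2)" for v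
      by (cases "v = 0") (simp_all add: powr_powr flip: powr_numeral)
    show ?thesis unfolding pw cmod_power2 by simp
  qed
  moreover have "((cmod a)\<^sup>2) powr (p / 2 - 1) = cmod a powr (p - 2)"
    using False by (simp add: powr_powr algebra_simps flip: powr_numeral)
  ultimately show ?thesis by (simp add: pderiv_at_def algebra_simps)
next
  case True
  then have p: "p > 1" using assms by simp
  have "((\<lambda>h. \<bar>h\<bar> powr p / h) \<longlongrightarrow> 0) (at (0::real))"
  proof -
    have "((\<lambda>h. \<bar>h\<bar> powr (p - 1)) \<longlongrightarrow> 0 powr (p - 1)) (at (0::real))"
      by (rule tendsto_powr'[OF tendsto_rabs_zero[OF tendsto_ident_at] tendsto_const]) (use p in auto)
    then have l: "((\<lambda>h. \<bar>h\<bar> powr (p - 1)) \<longlongrightarrow> 0) (at (0::real))" by simp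
    show ?thesis
    proof (rule Lim_null_comparison[OF _ l], rule always_eventually, intro allI)
      fix h :: real
      show "norm (\<bar>h\<bar> powr p / h) \<le> \<bar>h\<bar> powr (p - 1)"
        by (cases "h = 0") (simp_all add: powr_diff)
    qed
  qed
  then have "((\<lambda>h. \<bar>h\<bar> powr p / h * cmod b powr p) \<longlongrightarrow> 0) (at (0::real))"
    by (rule tendsto_mult_left_zero)
  then show ?thesis
    using True p by (simp add: DERIV_def pderiv_at_def norm_mult powr_mult mult.commute)
qed

section \<open>Growth bounds and convexity\<close>

lemma abs_powr_diff_le:
  fixes x y m p :: real
  assumes p: "p \<ge> 1" and "0 \<le> x" "0 \<le> y" "x \<le> m" "y \<le> m"
  shows "\<bar>x powr p - y powr p\<bar> \<le> p * m powr (p - 1) * \<bar>x - y\<bar>"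
proof -
  have main: "v powr p - u powr p \<le> p * m powr (p - 1) * (v - u)"
    if uv: "0 \<le> u" "u < v" "v \<le> m" for u v
  proof -
    have D: "((\<lambda>t. t powr p) has_real_derivative p * t powr (p - 1)) (at t)" if "u < t" "t < v" for t
      using that uv by (auto intro!: derivative_eq_intros)
    have "continuous_on {u..v} (\<lambda>t. t powr p)"
      using uv p by (intro continuous_on_powr' continuous_intros) auto
    then obtain l t where t: "u < t" "t < v" "((\<lambda>t. t powr p) has_real_derivative l) (at t)"
        "v powr p - u powr p = (v - u) * l"
      using MVT[OF uv(2), of "\<lambda>t. t powr p"] D by (auto simp: real_differentiable_def)
    have "l = p * t powr (p - 1)" using DERIV_unique[OF t(3) D] t by simp
    also have "\<dots> \<le> p * m powr (p - 1)"
      using p t uv by (intro mult_left_mono powr_mono2) auto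
    finally show ?thesis using t uv by (simp add: mult.commute mult_left_mono)
  qed
  consider "x < y" | "x = y" | "y < x" by linarith
  then show ?thesis
  proof cases
    case 1
    have "x powr p \<le> y powr p" using 1 assms by (intro powr_mono2) auto
    then show ?thesis using main[of x y] 1 assms by (simp add: abs_if)
  next
    case 3
    have "y powr p \<le> x powr p" using 3 assms by (intro powr_mono2) auto
    then show ?thesis using main[of y x] 3 assms by (simp add: abs_if)
  qed simp
qed

text \<open>After division by \<open>s\<close> the bound no longer depends on \<open>s\<close>,
  which makes it the majorant for difference quotients under the integral.\<close>

lemma abs_powr_norm_diff_le:
  fixes a b :: complex
  assumes p: "p \<ge> 1" and s: "\<bar>s\<bar> \<le> 1"
  shows "\<bar>cmod (a + of_real s * b) powr p - cmod a powr p\<bar> \<le> p * (cmod a + cmod b) powr p * \<bar>s\<bar>"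
proof -
  define m where "m = cmod a + cmod b"
  have sb: "cmod (of_real s * b) = \<bar>s\<bar> * cmod b" by (simp add: norm_mult)
  have sb': "\<bar>s\<bar> * cmod b \<le> cmod b" using s by (simp add: mult_left_le_one_le)
  have d: "\<bar>cmod (a + of_real s * b) - cmod a\<bar> \<le> \<bar>s\<bar> * m"
  proof -
    have "\<bar>cmod (a + of_real s * b) - cmod a\<bar> \<le> \<bar>s\<bar> * cmod b"
      using norm_triangle_ineq3[of "a + of_real s * b" a] sb by simp
    also have "\<dots> \<le> \<bar>s\<bar> * m" by (simp add: m_def mult_left_mono)
    finally show ?thesis .
  qed
  have "\<bar>cmod (a + of_real s * b) powr p - cmod a powr p\<bar> \<le> p * m powr (p - 1) * \<bar>cmod (a
      + of_real s * b) - cmod a\<bar>"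
    using norm_triangle_ineq[of a "of_real s * b"] sb sb'
    by (intro abs_powr_diff_le p) (auto simp: m_def)
  also have "\<dots> \<le> p * m powr (p - 1) * (\<bar>s\<bar> * m)"
    using p d by (intro mult_left_mono) auto
  also have "\<dots> = p * m powr p * \<bar>s\<bar>"
    by (cases "m = 0") (simp_all add: powr_diff m_def)
  finally show ?thesis by (simp add: m_def)
qed

text \<open>Convexity of the power function: the mean value theorem is applied on either side of
  \<open>y\<close>.\<close>

lemma powr_ge_tangent:
  fixes x y p :: real
  assumes p: "p \<ge> 1" and x: "x \<ge> 0" and y: "y > 0"
  shows "y powr p + p * y powr (p - 1) * (x - y) \<le> x powr p"
proof (cases "y \<le> x")
  case False
  then show ?thesis
    using abs_powr_diff_le[OF p, of y x y] x y powr_mono2[of p x y] p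
        by (simp add: algebra_simps abs_if split: if_splits)
next
  case True
  show ?thesis
  proof (cases "y = x")
    case False
    then have yx: "y < x" using True by simp
    have D: "((\<lambda>t. t powr p) has_real_derivative p * t powr (p - 1)) (at t)" if "y \<le> t" "t \<le> x" for t
      using that y by (auto intro!: derivative_eq_intros)
    obtain t where t: "y < t" "t < x" "x powr p - y powr p = (x - y) * (p * t powr (p - 1))"
      using MVT2[OF yx D] by blast
    have "p * y powr (p - 1) \<le> p * t powr (p - 1)"
      using p t y by (intro mult_left_mono powr_mono2) auto
    then have "p * y powr (p - 1) * (x - y) \<le> (x - y) * (p * t powr (p - 1))"
      using yx by (simp add: mult.commute[of "x - y"] mult_right_mono)
    then show ?thesis using t by linarith
  qed simp
qed

text \<open>The Cauchy-Schwarz inequality bounds \<open>Re (cnj a b)\<close> by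
  \<open>cmod a (cmod (a + b) - cmod a)\<close>, which reduces the claim to the tangent of the real
  power function.\<close>

lemma powr_norm_ge_tangent:
  fixes a b :: complex
  assumes p: "p \<ge> 1"
  shows "cmod a powr p + pderiv_at p a b \<le> cmod (a + b) powr p"
proof (cases "a = 0")
  case False
  have "Re (cnj a * (a + b)) \<le> cmod a * cmod (a + b)"
    using complex_Re_le_cmod[of "cnj a * (a + b)"] by (simp add: norm_mult)
  moreover have "Re (cnj a * (a + b)) = cmod a * cmod a + Re (cnj a * b)"
    using cmod_power2[of a] by (simp add: power2_eq_square algebra_simps)
  ultimately have r: "Re (cnj a * b) \<le> cmod a * (cmod (a + b) - cmod a)"
    by (simp add: algebra_simps)
  have "pderiv_at p a b \<le> p * cmod a powr (p - 2) * (cmod a * (cmod (a + b) - cmod a))"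
    unfolding pderiv_at_def using p r by (intro mult_left_mono) auto
  also have "\<dots> = p * cmod a powr (p - 1) * (cmod (a + b) - cmod a)"
    using False powr_mult_base[of "cmod a" "p - 2"] by (simp add: mult.assoc mult.left_commute)
  finally show ?thesis
    using powr_ge_tangent[OF p, of "cmod (a + b)" "cmod a"] False by simp
qed (simp add: pderiv_at_def)

lemma powr_add_le:
  fixes x y :: real
  assumes "x \<ge> 0" "y \<ge> 0" "p \<ge> 0"
  shows "(x + y) powr p \<le> 2 powr p * (x powr p + y powr p)"
proof -
  have "(x + y) powr p \<le> (2 * max x y) powr p" using assms by (intro powr_mono2) auto
  also have "\<dots> = 2 powr p * max x y powr p" using assms by (simp add: powr_mult)
  also have "\<dots> \<le> 2 powr p * (x powr p + y powr p)" by (intro mult_left_mono) (auto simp: max_def)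
  finally show ?thesis .
qed

lemma abs_pderiv_at_le:
  assumes p: "p \<ge> 1"
  shows "\<bar>pderiv_at p a b\<bar> \<le> p * (cmod a + cmod b) powr p"
proof (cases "a = 0")
  case False
  have "\<bar>pderiv_at p a b\<bar> = p * cmod a powr (p - 2) * \<bar>Re (cnj a * b)\<bar>"
    using p by (simp add: pderiv_at_def abs_mult)
  also have "\<dots> \<le> p * cmod a powr (p - 2) * (cmod a * cmod b)"
    using abs_Re_le_cmod[of "cnj a * b"] p by (intro mult_left_mono) (auto simp: norm_mult)
  also have "\<dots> = p * cmod a powr (p - 1) * cmod b"
    using False powr_mult_base[of "cmod a" "p - 2"] by (simp add: mult.assoc mult.left_commute)
  also have "\<dots> \<le> p * (cmod a + cmod b) powr (p - 1) * (cmod a + cmod b)"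
    using p by (intro mult_mono powr_mono2) auto
  also have "\<dots> = p * (cmod a + cmod b) powr p"
    using False powr_mult_base[of "cmod a + cmod b" "p - 1"] by (simp add: mult.assoc mult.commute)
  finally show ?thesis .
qed (use p in \<open>simp add: pderiv_at_def\<close>)

text \<open>It suffices to test on the two sets where \<open>d\<close> has constant sign, since a
  vanishing integral there forces \<open>d\<close> to vanish.\<close>

lemma AE_eq_zero_if_integrals_zero:
  fixes d :: "'m \<Rightarrow> real"
  assumes d: "integrable M d" and z: "\<And>A. A \<in> sets M \<Longrightarrow> (\<integral>x. indicator A x * d x \<partial>M) = 0"
  shows "AE x in M. d x = 0"
proof -
  have m: "d \<in> borel_measurable M" using d by simp
  have sgn: "AE x in M. indicator A x * d x = 0" if A: "A \<in> sets M" and s: "\<And>x. x \<in> A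
      \<Longrightarrow> c * d x \<ge> 0" "c \<noteq> 0" for A and c :: real
  proof -
    have "AE x in M. c * (indicator A x * d x) = 0"
    proof (subst integral_nonneg_eq_0_iff_AE[symmetric])
      show "integrable M (\<lambda>x. c * (indicator A x * d x))"
        using integrable_real_mult_indicator[OF A d] by (simp add: mult.commute)
      show "AE x in M. 0 \<le> c * (indicator A x * d x)"
        using s by (auto simp: indicator_def)
      show "(\<integral>x. c * (indicator A x * d x) \<partial>M) = 0" using z[OF A] by simp
    qed
    then show ?thesis using s(2) by simp
  qed
  have A: "{x \<in> space M. 0 \<le> d x} \<in> sets M" "{x \<in> space M. d x \<le> 0} \<in> sets M"
    using m by measurable
  have "AE x in M. indicator {x \<in> space M. 0 \<le> d x} x * d x = 0" by (rule sgn[OF A(1), of 1]) auto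
  moreover have "AE x in M. indicator {x \<in> space M. d x \<le> 0} x * d x = 0"
      by (rule sgn[OF A(2), of "-1"]) auto
  ultimately show ?thesis
    using AE_space by eventually_elim (auto simp: indicator_def split: if_splits)
qed


section \<open>Derivatives of the norm of an \<open>L\<^sup>p\<close>-space\<close>

text \<open>The derivative of \<open>norm (k + s \<xi>) powr p\<close> at \<open>s = 0\<close>.
  Symmetric quotients converge even for \<open>p = 1\<close> when \<open>k\<close> has zeros. Being
  built from the norm alone, the limit is carried along by isometries.\<close>

definition sderiv :: "real \<Rightarrow> 'e::real_normed_vector \<Rightarrow> 'e \<Rightarrow> real" where
  "sderiv p k \<xi> = lim (\<lambda>n. (norm (k + (1 / Suc n) *\<^sub>R \<xi>) powr p - norm (k
      - (1 / Suc n) *\<^sub>R \<xi>) powr p) * Suc n / 2)"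

lemma sderiv_cong:
  assumes "\<And>s. norm (k + s *\<^sub>R \<xi>) = norm (k' + s *\<^sub>R \<xi>')"
  shows "sderiv p k \<xi> = sderiv p k' \<xi>'"
proof -
  have "norm (k - s *\<^sub>R \<xi>) = norm (k' - s *\<^sub>R \<xi>')" for s using assms[of "- s"] by simp
  then show ?thesis unfolding sderiv_def using assms by simp
qed

locale Lp_quotient =
  fixes p :: real and M :: "'m measure" and q :: "('m \<Rightarrow> complex) \<Rightarrow> 'e::complex_banach"
  assumes p: "p \<ge> 1"
    and q_add: "\<And>f g. f \<in> Lp_functions p M \<Longrightarrow> g \<in> Lp_functions p M \<Longrightarrow> q (\<lambda>x. f x + g x) = q f + q g"
    and q_scaleC: "\<And>c f. f \<in> Lp_functions p M \<Longrightarrow> q (\<lambda>x. c * f x) = c *\<^sub>C q f"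
    and norm_q: "\<And>f. f \<in> Lp_functions p M \<Longrightarrow> norm (q f) = Lp_norm p M f"
    and q_surj: "q ` Lp_functions p M = UNIV"
begin

abbreviation L where "L \<equiv> Lp_functions p M"

lemma L_measurable [measurable_dest]: "f \<in> L \<Longrightarrow> f \<in> borel_measurable M"
  by (simp add: Lp_functions_def)

lemma L_integrable: "f \<in> L \<Longrightarrow> integrable M (\<lambda>x. cmod (f x) powr p)"
  by (simp add: Lp_functions_def)

lemma integrable_powr_norm_sum:
  assumes f: "f \<in> L" and g: "g \<in> L"
  shows "integrable M (\<lambda>x. (cmod (f x) + cmod (g x)) powr p)"
proof (rule Bochner_Integration.integrable_bound)
  show "integrable M (\<lambda>x. 2 powr p * (cmod (f x) powr p + cmod (g x) powr p))"
    using L_integrable[OF f] L_integrable[OF g] by simp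
  show "(\<lambda>x. (cmod (f x) + cmod (g x)) powr p) \<in> borel_measurable M"
    using f g by measurable
  show "AE x in M. norm ((cmod (f x) + cmod (g x)) powr p) \<le> norm (2 powr p * (cmod (f x) powr p
      + cmod (g x) powr p))"
    using powr_add_le p by (intro AE_I2) simp
qed

lemma L_add:
  assumes f: "f \<in> L" and g: "g \<in> L"
  shows "(\<lambda>x. f x + g x) \<in> L"
proof -
  have "integrable M (\<lambda>x. cmod (f x + g x) powr p)"
  proof (rule Bochner_Integration.integrable_bound[OF integrable_powr_norm_sum[OF f g]])
    show "(\<lambda>x. cmod (f x + g x) powr p) \<in> borel_measurable M"
      using f g by measurable
    show "AE x in M. norm (cmod (f x + g x) powr p) \<le> norm ((cmod (f x) + cmod (g x)) powr p)"
      using p by (auto intro!: powr_mono2 norm_triangle_ineq)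
  qed
  then show ?thesis using f g by (simp add: Lp_functions_def borel_measurable_add)
qed

lemma L_mult_bounded:
  assumes f: "f \<in> L" and h: "h \<in> borel_measurable M" and C: "\<And>x. cmod (h x) \<le> C"
  shows "(\<lambda>x. h x * f x) \<in> L"
proof -
  have "C \<ge> 0" using C norm_ge_zero order_trans by blast
  have "integrable M (\<lambda>x. cmod (h x * f x) powr p)"
  proof (rule Bochner_Integration.integrable_bound)
    show "integrable M (\<lambda>x. C powr p * cmod (f x) powr p)" using L_integrable[OF f] by simp
    show "(\<lambda>x. cmod (h x * f x) powr p) \<in> borel_measurable M"
      using f h by measurable
    show "AE x in M. norm (cmod (h x * f x) powr p) \<le> norm (C powr p * cmod (f x) powr p)"
      using p C \<open>C \<ge> 0\<close> by (auto simp: norm_mult powr_mult intro!: mult_right_mono powr_mono2)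
  qed
  then show ?thesis using f h by (simp add: Lp_functions_def borel_measurable_times)
qed

lemma L_scale: "f \<in> L \<Longrightarrow> (\<lambda>x. c * f x) \<in> L"
  by (rule L_mult_bounded[of _ _ "cmod c"]) auto

lemma L_restrict: "f \<in> L \<Longrightarrow> A \<in> sets M \<Longrightarrow> (\<lambda>x. indicator A x * f x) \<in> L"
  by (rule L_mult_bounded[of _ _ 1]) (auto simp: indicator_def)

lemma L_add_scale: "f \<in> L \<Longrightarrow> g \<in> L \<Longrightarrow> (\<lambda>x. f x + c * g x) \<in> L"
  using L_add L_scale by blast

lemma q_add_scale: "f \<in> L \<Longrightarrow> g \<in> L \<Longrightarrow> q (\<lambda>x. f x + c * g x) = q f + c *\<^sub>C q g"
  by (simp add: q_add q_scaleC L_scale)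

lemma q_repE: obtains f where "f \<in> L" "q f = \<xi>"
  using q_surj by (metis UNIV_I imageE)

lemma norm_q_powr:
  assumes f: "f \<in> L"
  shows "norm (q f) powr p = (\<integral>x. cmod (f x) powr p \<partial>M)"
proof -
  have "(\<integral>x. cmod (f x) powr p \<partial>M) \<ge> 0" by (rule Bochner_Integration.integral_nonneg) simp
  then show ?thesis using p by (simp add: norm_q[OF f] Lp_norm_def powr_powr)
qed

lemma pderiv_at_measurable:
  assumes f: "f \<in> L" and h: "h \<in> L"
  shows "(\<lambda>x. pderiv_at p (f x) (h x)) \<in> borel_measurable M"
proof -
  have [measurable]: "f \<in> borel_measurable M" "h \<in> borel_measurable M" using f h
      by (auto dest: L_measurable)
  have "(\<lambda>x. p * cmod (f x) powr (p - 2) * (f x \<bullet> h x)) \<in> borel_measurable M" by measurable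
  then show ?thesis by (simp add: pderiv_at_def inner_complex_def)
qed

lemma integrable_pderiv_at:
  assumes f: "f \<in> L" and h: "h \<in> L"
  shows "integrable M (\<lambda>x. pderiv_at p (f x) (h x))"
proof (rule Bochner_Integration.integrable_bound)
  show "integrable M (\<lambda>x. p * (cmod (f x) + cmod (h x)) powr p)"
    using integrable_powr_norm_sum[OF f h] by simp
  show "AE x in M. norm (pderiv_at p (f x) (h x)) \<le> norm (p * (cmod (f x) + cmod (h x)) powr p)"
    using abs_pderiv_at_le[OF p] p by (intro AE_I2) (simp add: abs_mult)
qed (rule pderiv_at_measurable[OF f h])

lemma norm_powr_line:
  assumes f: "f \<in> L" and h: "h \<in> L"
  shows "norm (q f + s *\<^sub>R q h) powr p = (\<integral>x. cmod (f x + of_real s * h x) powr p \<partial>M)"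
    "integrable M (\<lambda>x. cmod (f x + of_real s * h x) powr p)"
  using norm_q_powr[OF L_add_scale[OF f h, of "of_real s"]] L_integrable[OF L_add_scale[OF f h, of
      "of_real s"]]
  by (simp_all add: q_add_scale f h scaleC_of_real)

text \<open>Dominated convergence, shared by the forward and the symmetric quotients.\<close>

lemma tendsto_integral_quotient:
  fixes Q :: "nat \<Rightarrow> complex \<Rightarrow> complex \<Rightarrow> real"
  assumes f: "f \<in> L" and h: "h \<in> L"
    and m: "\<And>n. (\<lambda>x. Q n (f x) (h x)) \<in> borel_measurable M"
    and b: "\<And>n a b. \<bar>Q n a b\<bar> \<le> p * (cmod a + cmod b) powr p"
    and l: "\<And>a b. (\<lambda>n. Q n a b) \<longlonglongrightarrow> pderiv_at p a b"
  shows "(\<lambda>n. \<integral>x. Q n (f x) (h x) \<partial>M) \<longlonglongrightarrow> (\<integral>x. pderiv_at p (f x) (h x) \<partial>M)"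
proof (rule integral_dominated_convergence)
  show "integrable M (\<lambda>x. p * (cmod (f x) + cmod (h x)) powr p)"
    using integrable_powr_norm_sum[OF f h] by simp
qed (use b l m pderiv_at_measurable[OF f h] in auto)

lemma quotient_bound:
  "\<bar>(cmod (a + of_real (1 / Suc n) * b) powr p - cmod a powr p) * Suc n\<bar> \<le> p * (cmod a + cmod b) powr p"
proof -
  have "\<bar>cmod (a + of_real (1 / Suc n) * b) powr p - cmod a powr p\<bar> \<le> p * (cmod a
      + cmod b) powr p * \<bar>1 / Suc n\<bar>"
    by (rule abs_powr_norm_diff_le[OF p]) simp
  then show ?thesis by (simp add: abs_mult pos_le_divide_eq del: of_nat_Suc)
qed

lemma quotient_tendsto:
  assumes "a \<noteq> 0 \<or> p > 1"
  shows "(\<lambda>n. (cmod (a + of_real (1 / Suc n) * b) powr p - cmod a powr p) * Suc n) \<longlonglongrightarrow> pderiv_at p a b"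
proof -
  have "((\<lambda>s. (cmod (a + of_real s * b) powr p - cmod a powr p) / s) \<longlongrightarrow> pderiv_at p a b) (at 0)"
    using has_real_derivative_powr_norm[OF assms, of b] by (simp add: DERIV_def)
  moreover have "filterlim (\<lambda>n. 1 / Suc n) (at (0::real)) sequentially"
    unfolding filterlim_at using LIMSEQ_inverse_real_of_nat by (simp add: divide_inverse)
  ultimately have "(\<lambda>n. (cmod (a + of_real (1 / Suc n) * b) powr p - cmod a powr p) / (1 / Suc n))
      \<longlonglongrightarrow> pderiv_at p a b"
    by (rule filterlim_compose)
  then show ?thesis by (simp del: of_nat_Suc)
qed

text \<open>Smoothness of the norm for \<open>p > 1\<close>: one-sided quotients have the same limit
  as symmetric ones.\<close>

lemma tendsto_forward_quotient:
  assumes f: "f \<in> L" and h: "h \<in> L" and p1: "p > 1"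
  shows "(\<lambda>n. (norm (q f + (1 / Suc n) *\<^sub>R q h) powr p - norm (q f) powr p) * Suc n)
      \<longlonglongrightarrow> (\<integral>x. pderiv_at p (f x) (h x) \<partial>M)"
proof -
  have [measurable]: "f \<in> borel_measurable M" "h \<in> borel_measurable M" using f h
      by (auto dest: L_measurable)
  have "(norm (q f + (1 / Suc n) *\<^sub>R q h) powr p - norm (q f) powr p) * Suc n =
      (\<integral>x. (cmod (f x + of_real (1 / Suc n) * h x) powr p - cmod (f x) powr p) * Suc n \<partial>M)" for n
    unfolding norm_powr_line(1)[OF f h] norm_q_powr[OF f]
    using norm_powr_line(2)[OF f h, of "1 / Suc n"] L_integrable[OF f]
    by (simp add: Bochner_Integration.integral_diff del: of_nat_Suc)
  moreover have "(\<lambda>n. \<integral>x. (cmod (f x + of_real (1 / Suc n) * h x) powr p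
      - cmod (f x) powr p) * Suc n \<partial>M) \<longlonglongrightarrow> (\<integral>x. pderiv_at p (f x) (h x) \<partial>M)"
    by (rule tendsto_integral_quotient[OF f h _ quotient_bound quotient_tendsto]) (use p1 in auto)
  ultimately show ?thesis by simp
qed

text \<open>Differentiation under the integral sign. The formula is what makes \<open>sderiv\<close>
  real-linear in the direction.\<close>

lemma sderiv_q:
  assumes f: "f \<in> L" and h: "h \<in> L"
  shows "sderiv p (q f) (q h) = (\<integral>x. pderiv_at p (f x) (h x) \<partial>M)"
proof -
  have [measurable]: "f \<in> borel_measurable M" "h \<in> borel_measurable M" using f h
      by (auto dest: L_measurable)
  define Q where "Q n a b = (cmod (a + of_real (1 / Suc n) * b) powr p - cmod (a
      + of_real (- (1 / Suc n)) * b) powr p) * Suc n / 2"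
    for n a b
  define G where "G n a b = (cmod (a + of_real (1 / Suc n) * b) powr p - cmod a powr p) * Suc n"
      for n a b
  \<comment> \<open>The symmetric quotient is half the difference of the forward quotients along
    \<open>b\<close> and \<open>- b\<close>, so the bound carries over, as does the limit where the
    forward one exists.\<close>
  have QG: "Q n a b = (G n a b - G n a (- b)) / 2" for n a b
    unfolding Q_def G_def by (simp add: algebra_simps diff_divide_distrib del: of_nat_Suc)
  have "(\<lambda>n. \<integral>x. Q n (f x) (h x) \<partial>M) \<longlonglongrightarrow> (\<integral>x. pderiv_at p (f x) (h x) \<partial>M)"
  proof (rule tendsto_integral_quotient[OF f h])
    show "(\<lambda>x. Q n (f x) (h x)) \<in> borel_measurable M" for n unfolding Q_def by measurable
    show "\<bar>Q n a b\<bar> \<le> p * (cmod a + cmod b) powr p" for n a b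
    proof -
      have half: "\<bar>x\<bar> \<le> c \<Longrightarrow> \<bar>y\<bar> \<le> c \<Longrightarrow> \<bar>(x - y) / 2\<bar> \<le> c" for x y c :: real
        using abs_triangle_ineq4[of x y] by simp
      show ?thesis unfolding QG
        by (rule half) (use quotient_bound[of a n b] quotient_bound[of a n "- b"] in
            \<open>simp_all only: G_def norm_minus_cancel\<close>)
    qed
    show "(\<lambda>n. Q n a b) \<longlonglongrightarrow> pderiv_at p a b" for a b
    proof (cases "a \<noteq> 0 \<or> p > 1")
      case True
      have "(\<lambda>n. Q n a b) \<longlonglongrightarrow> (pderiv_at p a b - pderiv_at p a (- b)) / 2"
        unfolding QG G_def by (intro tendsto_intros quotient_tendsto True) simp
      moreover have "pderiv_at p a (- b) = - pderiv_at p a b" by (simp add: pderiv_at_def algebra_simps)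
      ultimately show ?thesis by simp
    next
      \<comment> \<open>Here \<open>a = 0\<close>, and the two terms of the symmetric quotient
        cancel.\<close>
      case False
      then show ?thesis by (simp add: Q_def pderiv_at_def norm_mult)
    qed
  qed
  moreover have "(norm (q f + (1 / Suc n) *\<^sub>R q h) powr p - norm (q f
      - (1 / Suc n) *\<^sub>R q h) powr p) * Suc n / 2
      = (\<integral>x. Q n (f x) (h x) \<partial>M)" for n
  proof -
    have "norm (q f - (1 / Suc n) *\<^sub>R q h) = norm (q f + (- (1 / Suc n)) *\<^sub>R q h)" by simp
    then show ?thesis
      unfolding Q_def norm_powr_line(1)[OF f h]
      using norm_powr_line(2)[OF f h, of "1 / Suc n"] norm_powr_line(2)[OF f h, of "- (1 / Suc n)"]
      by (simp add: Bochner_Integration.integral_diff norm_powr_line(1)[OF f h] del: of_nat_Suc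
          of_real_minus scaleR_minus_left)
  qed
  ultimately show ?thesis unfolding sderiv_def by (simp add: limI)
qed

lemma sderiv_add: "sderiv p (k::'e) (\<xi> + \<eta>) = sderiv p k \<xi> + sderiv p k \<eta>"
proof -
  obtain f g h where f: "f \<in> L" "q f = k" and g: "g \<in> L" "q g = \<xi>" and h: "h \<in> L" "q h = \<eta>"
    using q_repE by metis
  show ?thesis
    using sderiv_q[OF f(1) g(1)] sderiv_q[OF f(1) h(1)] sderiv_q[OF f(1) L_add[OF g(1) h(1)]]
      integrable_pderiv_at[OF f(1) g(1)] integrable_pderiv_at[OF f(1) h(1)]
    by (simp add: f g h q_add pderiv_at_add)
qed

lemma sderiv_scaleR: "sderiv p (k::'e) (r *\<^sub>R \<xi>) = r * sderiv p k \<xi>"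
proof -
  obtain f g where f: "f \<in> L" "q f = k" and g: "g \<in> L" "q g = \<xi>"
    using q_repE by metis
  have "pderiv_at p a (of_real r * b) = r * pderiv_at p a b" for a b
    by (simp add: pderiv_at_def algebra_simps)
  then show ?thesis
    using sderiv_q[OF f(1) g(1)] sderiv_q[OF f(1) L_scale[OF g(1), of "of_real r"]]
    by (simp add: f g q_scaleC scaleC_of_real)
qed

lemma sderiv_minus: "sderiv p (k::'e) (- \<xi>) = - sderiv p k \<xi>"
  using sderiv_scaleR[of k "-1" \<xi>] by simp

lemma sderiv_diff: "sderiv p (k::'e) (\<xi> - \<eta>) = sderiv p k \<xi> - sderiv p k \<eta>"
  using sderiv_add[of k \<xi> "- \<eta>"] by (simp add: sderiv_minus)

text \<open>\<open>sderiv p k\<close> is a subgradient at \<open>k\<close>, by integrating the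
  pointwise tangent inequality.\<close>

lemma sderiv_le: "norm (k::'e) powr p + sderiv p k \<xi> \<le> norm (k + \<xi>) powr p"
proof -
  obtain f g where f: "f \<in> L" "q f = k" and g: "g \<in> L" "q g = \<xi>"
    using q_repE by metis
  have "(\<integral>x. cmod (f x) powr p + pderiv_at p (f x) (g x) \<partial>M) \<le> (\<integral>x. cmod (f x + g x) powr p \<partial>M)"
    using L_integrable[OF f(1)] integrable_pderiv_at[OF f(1) g(1)] L_integrable[OF L_add[OF f(1) g(1)]]
    by (intro integral_mono powr_norm_ge_tangent[OF p]) auto
  then show ?thesis
    using norm_q_powr[OF f(1)] norm_q_powr[OF L_add[OF f(1) g(1)]] sderiv_q[OF f(1) g(1)]
      L_integrable[OF f(1)] integrable_pderiv_at[OF f(1) g(1)]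
    by (simp add: f g q_add)
qed

text \<open>The subgradient inequality bounds \<open>s * sderiv p k (T e \<xi>)\<close> by
  \<open>norm (k + s T e \<xi>) powr p - norm k powr p\<close>, and \<open>k + s T e \<xi>\<close>
  equals \<open>T e (k + s \<xi>)\<close> up to the vanishing error \<open>k - T e k\<close>.
  Forward quotients then give the upper estimate, and \<open>- \<xi>\<close> gives the lower
  one.\<close>

lemma tendsto_sderiv_contractions:
  fixes T :: "'i \<Rightarrow> 'e \<Rightarrow> 'e"
  assumes p1: "p > 1"
    and lin: "\<And>e. linear (T e)"
    and contr: "\<forall>\<^sub>F e in F. \<forall>\<xi>. norm (T e \<xi>) \<le> norm \<xi>"
    and k: "((\<lambda>e. T e k) \<longlongrightarrow> k) F"
  shows "((\<lambda>e. sderiv p k (T e \<xi>)) \<longlongrightarrow> sderiv p k \<xi>) F"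
proof -
  have up: "\<forall>\<^sub>F e in F. sderiv p k (T e \<xi>) < c" if c: "sderiv p k \<xi> < c" for \<xi> c
  proof -
    obtain f g where f: "f \<in> L" "q f = k" and g: "g \<in> L" "q g = \<xi>"
      using q_repE by metis
    have "(\<lambda>n. (norm (k + (1 / Suc n) *\<^sub>R \<xi>) powr p - norm k powr p) * Suc n) \<longlonglongrightarrow> sderiv p k \<xi>"
      using tendsto_forward_quotient[OF f(1) g(1) p1] sderiv_q[OF f(1) g(1)] by (simp add: f g)
    then have "\<forall>\<^sub>F n in sequentially. (norm (k + (1 / Suc n) *\<^sub>R \<xi>) powr p - norm k powr p) * Suc n < c"
      using c by (rule order_tendstoD)
    then obtain n where n: "(norm (k + (1 / Suc n) *\<^sub>R \<xi>) powr p - norm k powr p) * Suc n < c"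
      by (auto simp: eventually_sequentially)
    \<comment> \<open>A step at which the forward quotient is already below \<open>c\<close>; it
      stays fixed while \<open>e\<close> varies.\<close>
    define s where "s = 1 / real (Suc n)"
    have s: "s > 0" and n': "(norm (k + s *\<^sub>R \<xi>) powr p - norm k powr p) / s < c"
      using n by (simp_all add: s_def)
    have "((\<lambda>e. ((norm (k - T e k) + norm (k + s *\<^sub>R \<xi>)) powr p - norm k powr p) / s) \<longlongrightarrow>
        ((norm (k - k) + norm (k + s *\<^sub>R \<xi>)) powr p - norm k powr p) / s) F"
      using s p1 by (intro tendsto_intros k tendsto_powr') auto
    then have "\<forall>\<^sub>F e in F. ((norm (k - T e k) + norm (k + s *\<^sub>R \<xi>)) powr p - norm k powr p) / s < c"
      using n' by (intro order_tendstoD) auto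
    then show ?thesis
      using contr
    proof eventually_elim
      case (elim e)
      have "norm (k + s *\<^sub>R T e \<xi>) = norm ((k - T e k) + T e (k + s *\<^sub>R \<xi>))"
        by (simp add: linear_add[OF lin] linear_scale[OF lin])
      also have "\<dots> \<le> norm (k - T e k) + norm (k + s *\<^sub>R \<xi>)"
        using elim(2) by (intro norm_triangle_le add_left_mono) auto
      finally have "norm (k + s *\<^sub>R T e \<xi>) powr p \<le> (norm (k - T e k) + norm (k + s *\<^sub>R \<xi>)) powr p"
        using p by (intro powr_mono2) auto
      then have "s * sderiv p k (T e \<xi>) \<le> (norm (k - T e k) + norm (k + s *\<^sub>R \<xi>)) powr p - norm k powr p"
        using sderiv_le[of k "s *\<^sub>R T e \<xi>"] by (simp add: sderiv_scaleR)
      then have "sderiv p k (T e \<xi>) \<le> ((norm (k - T e k) + norm (k + s *\<^sub>R \<xi>)) powr p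
          - norm k powr p) / s"
        using s by (simp add: field_simps)
      then show ?case using elim(1) by simp
    qed
  qed
  show ?thesis
  proof (rule order_tendstoI)
    fix c assume "c < sderiv p k \<xi>"
    then show "\<forall>\<^sub>F e in F. c < sderiv p k (T e \<xi>)"
      using up[of "- \<xi>" "- c"] by (simp add: sderiv_minus linear_neg[OF lin])
  qed (rule up)
qed

end


section \<open>Hermitian projections on subspaces of \<open>L\<^sup>p\<close>-spaces\<close>

text \<open>The operators \<open>T e\<close> with values in the subspace \<open>E\<close> replace a contractive projection of \<open>L\<^sup>p\<close>
  onto \<open>E\<close>: functionals of the form \<open>sderiv p k\<close> with \<open>k \<in> E\<close> are determined by their values on \<open>E\<close>.\<close>

locale Lp_subspace = Lp_quotient p M q
  for p :: real and M :: "'m measure" and q :: "('m \<Rightarrow> complex) \<Rightarrow> 'e::complex_banach" +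
  fixes E :: "'e set" and T :: "'i \<Rightarrow> 'e \<Rightarrow> 'e" and F :: "'i filter"
  assumes p2: "p \<noteq> 2" and E_add: "\<And>\<xi> \<eta>. \<xi> \<in> E \<Longrightarrow> \<eta> \<in> E \<Longrightarrow> \<xi> + \<eta> \<in> E"
    and E_scaleC: "\<And>c \<xi>. \<xi> \<in> E \<Longrightarrow> c *\<^sub>C \<xi> \<in> E"
    and F: "F \<noteq> bot" and T_E: "\<And>e \<xi>. T e \<xi> \<in> E"
    and T_scaleC: "\<And>e c \<xi>. T e (c *\<^sub>C \<xi>) = c *\<^sub>C T e \<xi>"
    and tendsto_sderiv: "\<And>k \<xi>. k \<in> E \<Longrightarrow> ((\<lambda>e. sderiv p k (T e \<xi>)) \<longlongrightarrow> sderiv p k \<xi>) F"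
begin

lemma E_diff: "\<xi> \<in> E \<Longrightarrow> \<eta> \<in> E \<Longrightarrow> \<xi> - \<eta> \<in> E"
  using E_add[of \<xi> "(-1) *\<^sub>C \<eta>"] E_scaleC[of \<eta> "-1"] by (simp add: scaleC_minus_left scaleC_one)

text \<open>The isometry condition is confined to \<open>E\<close>, because norms in the unitization
  control its operators only there.\<close>

definition hermitian_projection :: "('e \<Rightarrow> 'e) \<Rightarrow> bool" where
  "hermitian_projection P \<longleftrightarrow> (\<forall>\<xi>\<in>E. P \<xi> \<in> E \<and> P (P \<xi>) = P \<xi>) \<and> (\<forall>\<xi> \<eta>. P (\<xi> + \<eta>) = P \<xi> + P \<eta>) \<and>
    (\<forall>c \<xi>. P (c *\<^sub>C \<xi>) = c *\<^sub>C P \<xi>) \<and>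
    (\<forall>z. \<forall>\<xi>\<in>E. cmod z = 1 \<longrightarrow> norm (P \<xi> + z *\<^sub>C (\<xi> - P \<xi>)) = norm \<xi>)"

lemma hermitian_projectionD:
  assumes "hermitian_projection P"
  shows "\<xi> \<in> E \<Longrightarrow> P \<xi> \<in> E" "\<xi> \<in> E \<Longrightarrow> P (P \<xi>) = P \<xi>" "P (\<xi> + \<eta>) = P \<xi> + P \<eta>"
    "P (c *\<^sub>C \<xi>) = c *\<^sub>C P \<xi>" "P (r *\<^sub>R \<xi>) = r *\<^sub>R P \<xi>" "P (\<xi> - \<eta>) = P \<xi> - P \<eta>"
    "\<xi> \<in> E \<Longrightarrow> cmod z = 1 \<Longrightarrow> norm (P \<xi> + z *\<^sub>C (\<xi> - P \<xi>)) = norm \<xi>"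
proof -
  show c: "P (c *\<^sub>C \<xi>) = c *\<^sub>C P \<xi>" for c \<xi> using assms by (auto simp: hermitian_projection_def)
  show a: "P (\<xi> + \<eta>) = P \<xi> + P \<eta>" for \<xi> \<eta> using assms by (auto simp: hermitian_projection_def)
  show "P (r *\<^sub>R \<xi>) = r *\<^sub>R P \<xi>" using c[of "of_real r" \<xi>] by (simp add: scaleC_of_real)
  show "P (\<xi> - \<eta>) = P \<xi> - P \<eta>"
    using a[of "\<xi> - \<eta>" \<eta>] by simp
qed (use assms in \<open>auto simp: hermitian_projection_def\<close>)

text \<open>The isometry \<open>P + z (1 - P)\<close> of \<open>E\<close> maps
  \<open>k = f + g\<close> to \<open>f + z g\<close> and \<open>\<eta>\<close> to
  \<open>\<xi>\<close>, so the derivative at \<open>f + z g\<close> along \<open>\<xi>\<close> is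
  the one at \<open>k\<close> along \<open>\<eta>\<close>.\<close>

lemma sderiv_rotate:
  assumes P: "hermitian_projection P" and f: "f \<in> E" "P f = f" and g: "g \<in> E" "P g = 0"
    and z: "cmod z = 1" and \<xi>: "\<xi> \<in> E"
  shows "sderiv p (f + z *\<^sub>C g) \<xi> = sderiv p (f + g) (P \<xi>) + sderiv p (f + g) (cnj z *\<^sub>C (\<xi> - P \<xi>))"
proof -
  note P' = hermitian_projectionD[OF P]
  define k where "k = f + g"
  define \<eta> where "\<eta> = P \<xi> + cnj z *\<^sub>C (\<xi> - P \<xi>)"
  have z1: "z * cnj z = 1" using z by (metis complex_norm_square of_real_1 power_one)
  have E: "k \<in> E" "\<eta> \<in> E"
    unfolding k_def \<eta>_def using f g \<xi> by (auto intro!: E_add E_scaleC E_diff P'(1))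
  have Pk: "P k = f" "k - P k = g" by (simp_all add: k_def P' f g)
  have P\<eta>: "P \<eta> = P \<xi>" "\<eta> - P \<eta> = cnj z *\<^sub>C (\<xi> - P \<xi>)"
    by (simp_all add: \<eta>_def P' \<xi>)
  have "norm (k + s *\<^sub>R \<eta>) = norm ((f + z *\<^sub>C g) + s *\<^sub>R \<xi>)" for s
  proof -
    have "P (k + s *\<^sub>R \<eta>) + z *\<^sub>C ((k + s *\<^sub>R \<eta>) - P (k + s *\<^sub>R \<eta>))
        = (P k + z *\<^sub>C (k - P k)) + s *\<^sub>R (P \<eta> + z *\<^sub>C (\<eta> - P \<eta>))"
      by (simp add: P' scaleC_add_right scaleC_diff_right scaleC_scaleC scaleR_scaleC algebra_simps)
    also have "\<dots> = (f + z *\<^sub>C g) + s *\<^sub>R \<xi>"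
      unfolding Pk(2) P\<eta>(2) unfolding Pk(1) P\<eta>(1) by (simp add: scaleC_scaleC z1 scaleC_one)
    finally show ?thesis
      using P'(7)[of "k + s *\<^sub>R \<eta>" z] E z by (simp add: E_add E_scaleC scaleR_scaleC)
  qed
  then have "sderiv p (f + z *\<^sub>C g) \<xi> = sderiv p k \<eta>" by (intro sderiv_cong) simp
  then show ?thesis by (simp add: k_def \<eta>_def sderiv_add)
qed

lemma AE_disjoint:
  assumes P: "hermitian_projection P" and f: "f \<in> L" "q f \<in> E" "P (q f) = q f"
    and g: "g \<in> L" "q g \<in> E" "P (q g) = 0"
  shows "AE x in M. f x * g x = 0"
proof -
  define N where "N z \<xi> = sderiv p (q f + z *\<^sub>C q g) \<xi>" for z \<xi>
  have NE: "q f + z *\<^sub>C q g \<in> E" for z by (intro E_add E_scaleC f g)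
  note rot = sderiv_rotate[OF P f(2,3) g(2,3), folded N_def]
  \<comment> \<open>The kernel component enters with the factor \<open>cnj z\<close> and cancels
    between \<open>z\<close> and \<open>- z\<close>; the rest does not involve \<open>z\<close>.
    This holds on \<open>E\<close>, and the limit along \<open>T e\<close> extends it to all
    vectors.\<close>
  have even: "N z \<xi> + N (- z) \<xi> = N 1 \<xi> + N (- 1) \<xi>" if z: "cmod z = 1" for z \<xi>
  proof -
    have l: "((\<lambda>e. N z (T e \<xi>) + N (- z) (T e \<xi>)) \<longlongrightarrow> N z \<xi> + N (- z) \<xi>) F" for z
      unfolding N_def by (intro tendsto_add tendsto_sderiv NE)
    have "N z \<xi> + N (- z) \<xi> = 2 * sderiv p (q f + q g) (P \<xi>)" if "\<xi> \<in> E" "cmod z = 1" for \<xi> z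
      using that by (simp add: rot scaleC_minus_left sderiv_minus)
    then have "N z (T e \<xi>) + N (- z) (T e \<xi>) = N 1 (T e \<xi>) + N (- 1) (T e \<xi>)" for e
      using T_E z by simp
    then show ?thesis using tendsto_unique[OF F l[of z]] l[of 1] by simp
  qed
  \<comment> \<open>The difference keeps only the kernel component, and the argument
    \<open>z \<xi>\<close> compensates its factor \<open>cnj z\<close>.\<close>
  have odd: "N z (z *\<^sub>C \<xi>) - N (- z) (z *\<^sub>C \<xi>) = N 1 \<xi> - N (- 1) \<xi>" if z: "cmod z = 1" for z \<xi>
  proof -
    have l: "((\<lambda>e. N z (z *\<^sub>C T e \<xi>) - N (- z) (z *\<^sub>C T e \<xi>)) \<longlongrightarrow> N z (z *\<^sub>C \<xi>)
        - N (- z) (z *\<^sub>C \<xi>)) F" for z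
      unfolding N_def T_scaleC[symmetric] by (intro tendsto_diff tendsto_sderiv NE)
    have "N z (z *\<^sub>C \<xi>) - N (- z) (z *\<^sub>C \<xi>) = 2 * sderiv p (q f + q g) (\<xi> - P \<xi>)" if "\<xi> \<in> E"
        and z: "cmod z = 1" for \<xi> z
    proof -
      have z1: "cnj z * z = 1" using z by (metis complex_norm_square mult.commute of_real_1 power_one)
      have "cnj z *\<^sub>C (z *\<^sub>C \<xi> - z *\<^sub>C P \<xi>) = \<xi> - P \<xi>"
        by (simp add: scaleC_diff_right scaleC_scaleC z1 scaleC_one)
      then show ?thesis
        using that by (simp add: rot E_scaleC hermitian_projectionD[OF P] scaleC_minus_left
            sderiv_minus sderiv_diff)
    qed
    then have "N z (z *\<^sub>C T e \<xi>) - N (- z) (z *\<^sub>C T e \<xi>) = N 1 (1 *\<^sub>C T e \<xi>)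
        - N (- 1) (1 *\<^sub>C T e \<xi>)" for e
      using T_E z by simp
    then show ?thesis using tendsto_unique[OF F l[of z]] l[of 1] by (simp add: scaleC_one)
  qed
  define D where "D z x = cmod (f x + z * g x) powr p + cmod (f x - z * g x) powr p" for z x
  have Ng: "(\<lambda>x. f x - z * g x) \<in> L" "(\<lambda>x. f x + z * g x) \<in> L" for z
    using L_add_scale[OF f(1) g(1), of "- z"] L_add_scale[OF f(1) g(1), of z] by simp_all
  have D_int: "integrable M (D z)" for z
    unfolding D_def using L_integrable[OF Ng(1)] L_integrable[OF Ng(2)]
        by (intro Bochner_Integration.integrable_add)
  \<comment> \<open>Differentiating along the vector itself, cut down to \<open>A\<close>, gives
    back its \<open>p\<close>-th power on \<open>A\<close>.\<close>
  have self: "N z (q (\<lambda>x. indicator A x * (f x + z * g x))) = p * (\<integral>x. indicator A x * cmod (f x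
      + z * g x) powr p \<partial>M)"
    if "A \<in> sets M" for A z
  proof -
    have "pderiv_at p a (indicator A x * a) = p * (indicator A x * cmod a powr p)" for x a
      by (cases "x \<in> A") (simp_all add: pderiv_at_self, simp add: pderiv_at_def)
    then show ?thesis
      using sderiv_q[OF Ng(2) L_restrict[OF Ng(2) that], of z z] by (simp add: N_def q_add_scale f g)
  qed
  have "AE x in M. D z x = D 1 x" if z: "cmod z = 1" for z
  proof -
    have I: "(\<integral>x. indicator A x * D z x \<partial>M) = (\<integral>x. indicator A x * D 1 x \<partial>M)" if A: "A \<in> sets M" for A
    proof -
      define \<xi> \<eta> where "\<xi> = q (\<lambda>x. indicator A x * f x)" and "\<eta> = q (\<lambda>x. indicator A x * g x)"
      have r: "q (\<lambda>x. indicator A x * (f x + w * g x)) = \<xi> + w *\<^sub>C \<eta>" for w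
        using q_add_scale[OF L_restrict[OF f(1) A] L_restrict[OF g(1) A], of w]
        by (simp add: \<xi>_def \<eta>_def algebra_simps)
      have "p * (\<integral>x. indicator A x * D w x \<partial>M) = N w (\<xi> + w *\<^sub>C \<eta>) + N (- w) (\<xi> + (- w) *\<^sub>C \<eta>)" for w
      proof -
        have i: "integrable M (\<lambda>x. indicator A x * cmod (f x + w * g x) powr p)" for w
          using integrable_real_mult_indicator[OF A L_integrable[OF Ng(2)]] by (simp add: mult.commute)
        show ?thesis
          using i[of w] i[of "- w"] unfolding r[symmetric] self[OF A] D_def
          by (simp add: algebra_simps)
      qed
      \<comment> \<open>The terms are regrouped into an even part in \<open>\<xi>\<close> and an odd
        part in \<open>\<eta>\<close>; neither depends on \<open>w\<close> when \<open>w\<close> is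
        unimodular.\<close>
      moreover have "N w (\<xi> + w *\<^sub>C \<eta>) + N (- w) (\<xi> + (- w) *\<^sub>C \<eta>) =
          (N w \<xi> + N (- w) \<xi>) + (N w (w *\<^sub>C \<eta>) - N (- w) (w *\<^sub>C \<eta>))" for w
        by (simp add: N_def sderiv_add sderiv_diff scaleC_minus_left)
      ultimately have "p * (\<integral>x. indicator A x * D z x \<partial>M) = p * (\<integral>x. indicator A x * D 1 x \<partial>M)"
        using even[OF z, of \<xi>] odd[OF z, of \<eta>] by (simp add: scaleC_one)
      then show ?thesis using p by simp
    qed
    have "AE x in M. D z x - D 1 x = 0"
    proof (rule AE_eq_zero_if_integrals_zero)
      fix A assume A: "A \<in> sets M"
      have "integrable M (\<lambda>x. indicator A x * D w x)" for w
        using integrable_real_mult_indicator[OF A D_int] by (simp add: mult.commute)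
      then show "(\<integral>x. indicator A x * (D z x - D 1 x) \<partial>M) = 0"
        using I[OF A] by (simp add: right_diff_distrib)
    qed (use D_int in simp)
    then show ?thesis by simp
  qed
  from this[of \<i>] this[of "Complex (3/5) (4/5)"]
  have "AE x in M. D \<i> x = D 1 x" "AE x in M. D (Complex (3/5) (4/5)) x = D 1 x"
    by (simp_all add: complex_norm power2_eq_square)
  then show ?thesis
  proof eventually_elim
    case (elim x)
    show ?case
      by (rule powr_norm_rotations_eq_imp[of p]) (use elim p p2 in \<open>auto simp: D_def\<close>)
  qed
qed

text \<open>Representatives of \<open>f\<close> and \<open>g\<close> have disjoint supports, so the
  \<open>p\<close>-th powers of the moduli add pointwise.\<close>

lemma norm_powr_add:
  assumes P: "hermitian_projection P" and f: "f \<in> E" "P f = f" and g: "g \<in> E" "P g = 0"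
  shows "norm (f + g) powr p = norm f powr p + norm g powr p"
proof -
  obtain u v where u: "u \<in> L" "q u = f" and v: "v \<in> L" "q v = g" using q_repE by metis
  have "AE x in M. u x * v x = 0" by (rule AE_disjoint[OF P]) (use u v f g in auto)
  then have ae: "AE x in M. cmod (u x + v x) powr p = cmod (u x) powr p + cmod (v x) powr p"
    by eventually_elim auto
  have [measurable]: "u \<in> borel_measurable M" "v \<in> borel_measurable M" using u v
      by (auto dest: L_measurable)
  have "norm (f + g) powr p = (\<integral>x. cmod (u x + v x) powr p \<partial>M)"
    using norm_q_powr[OF L_add[OF u(1) v(1)]] by (simp add: q_add u v)
  also have "\<dots> = (\<integral>x. cmod (u x) powr p + cmod (v x) powr p \<partial>M)"
    by (rule integral_cong_AE[OF _ _ ae]) measurable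
  also have "\<dots> = norm f powr p + norm g powr p"
    using L_integrable[OF u(1)] L_integrable[OF v(1)] norm_q_powr[OF u(1)] norm_q_powr[OF v(1)]
        by (simp add: u v)
  finally show ?thesis .
qed

text \<open>It suffices that \<open>P\<close> preserves the range and the kernel of
  \<open>R\<close>. For \<open>\<zeta>\<close> in one of them, the component of
  \<open>P \<zeta>\<close> in the other is disjoint from the remaining component and from
  \<open>\<zeta>\<close>, which forces it to be zero.\<close>

lemma hermitian_projections_commute:
  assumes P: "hermitian_projection P" and R: "hermitian_projection R" and \<xi>: "\<xi> \<in> E"
  shows "P (R \<xi>) = R (P \<xi>)"
proof -
  note P' = hermitian_projectionD[OF P] and R' = hermitian_projectionD[OF R]
  \<comment> \<open>At a point where \<open>y\<close> is nonzero, \<open>u\<close> vanishes and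
    \<open>y + u + v = 0\<close>, so \<open>v = - y\<close>. But \<open>y + u\<close> and
    \<open>v\<close> lie in the range and the kernel of \<open>P\<close>, hence are
    disjoint.\<close>
  have zero: "y = 0" if E: "y \<in> E" "u \<in> E" "v \<in> E"
    and yu: "\<And>a b. a \<in> L \<Longrightarrow> b \<in> L \<Longrightarrow> q a = y \<Longrightarrow> q b = u \<Longrightarrow> AE x in M. a x * b x = 0"
    and yuv: "\<And>a b. a \<in> L \<Longrightarrow> b \<in> L \<Longrightarrow> q a = y \<Longrightarrow> q b = y + u + v \<Longrightarrow> AE x in M. a x * b x = 0"
    and v: "P (y + u) = y + u" "P v = 0" for y u v
  proof -
    obtain a b c where a: "a \<in> L" "q a = y" and b: "b \<in> L" "q b = u" and c: "c \<in> L" "q c = v"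
      using q_repE by metis
    have "AE x in M. a x * b x = 0" using yu a b by blast
    moreover have "AE x in M. a x * (a x + b x + c x) = 0"
      by (rule yuv) (simp_all add: a b c L_add q_add)
    moreover have "AE x in M. (a x + b x) * c x = 0"
      by (rule AE_disjoint[OF P]) (simp_all add: a b c L_add q_add E E_add v)
    ultimately have "AE x in M. a x = 0"
      by eventually_elim (auto simp: add_eq_0_iff)
    then have ae: "AE x in M. cmod (a x) powr p = 0" by eventually_elim simp
    have [measurable]: "a \<in> borel_measurable M" using a by (auto dest: L_measurable)
    have "norm y powr p = (\<integral>x. 0 \<partial>M)"
      unfolding a(2)[symmetric] norm_q_powr[OF a(1)] by (rule integral_cong_AE[OF _ _ ae]) measurable
    then show "y = 0" by simp
  qed
  have ran: "R (P \<zeta>) = P \<zeta>" if \<zeta>: "\<zeta> \<in> E" "R \<zeta> = \<zeta>" for \<zeta>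
  proof -
    have "P \<zeta> - R (P \<zeta>) = 0"
    proof (rule zero[of _ "R (P \<zeta>)" "\<zeta> - P \<zeta>"])
      show "AE x in M. a x * b x = 0" if "a \<in> L" "b \<in> L" "q a = P \<zeta> - R (P \<zeta>)" "q b = R (P \<zeta>)" for a b
        using AE_disjoint[OF R that(2) _ _ that(1)] that \<zeta> by (simp add: P' R' E_diff mult.commute)
      show "AE x in M. a x * b x = 0" if "a \<in> L" "b \<in> L" "q a = P \<zeta> - R (P \<zeta>)"
        "q b = P \<zeta> - R (P \<zeta>) + R (P \<zeta>) + (\<zeta> - P \<zeta>)" for a b
        using AE_disjoint[OF R that(2) _ _ that(1)] that \<zeta> by (simp add: P' R' E_diff mult.commute)
    qed (use \<zeta> in \<open>simp_all add: P' R' E_diff\<close>)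
    then show ?thesis by simp
  qed
  have ker: "R (P \<zeta>) = 0" if \<zeta>: "\<zeta> \<in> E" "R \<zeta> = 0" for \<zeta>
  proof (rule zero[of _ "P \<zeta> - R (P \<zeta>)" "\<zeta> - P \<zeta>"])
    show "AE x in M. a x * b x = 0" if "a \<in> L" "b \<in> L" "q a = R (P \<zeta>)" "q b = P \<zeta> - R (P \<zeta>)" for a b
      using AE_disjoint[OF R that(1) _ _ that(2)] that \<zeta> by (simp add: P' R' E_diff)
    show "AE x in M. a x * b x = 0" if "a \<in> L" "b \<in> L" "q a = R (P \<zeta>)"
      "q b = R (P \<zeta>) + (P \<zeta> - R (P \<zeta>)) + (\<zeta> - P \<zeta>)" for a b
      using AE_disjoint[OF R that(1) _ _ that(2)] that \<zeta> by (simp add: P' R' E_diff)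
  qed (use \<zeta> in \<open>simp_all add: P' R' E_diff\<close>)
  have "R (P \<xi>) = R (P (R \<xi>)) + R (P (\<xi> - R \<xi>))" by (simp add: P' R')
  also have "\<dots> = P (R \<xi>)" using ran[of "R \<xi>"] ker[of "\<xi> - R \<xi>"] \<xi> by (simp add: R' E_diff)
  finally show ?thesis by simp
qed

end


section \<open>Operator algebras on \<open>L\<^sup>p\<close>-spaces\<close>

text \<open>Hermitian idempotents become hermitian projections of the essential subspace, and the
  properties found there are transferred back along the isometry \<open>\<phi>\<close>.\<close>

lemma Lp_operator_algebra_hermitian_idempotents:
  fixes \<phi> :: "'a::complex_banach_algebra \<Rightarrow> ('e::complex_banach \<Rightarrow>\<^sub>L 'e)" and M :: "'m measure"
  assumes au: "approximately_unital TYPE('a)"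
    and M: "is_Lp_space TYPE('e) p M" and p: "p \<ge> 1" "p \<noteq> 2"
    and \<phi>: "isometric_representation \<phi>" and nd: "p > 1 \<or> nondegenerate \<phi>"
  shows "hermitian_idempotents_ultrahermitian_and_commute TYPE('a)"
proof -
  obtain F :: "'a filter" where F: "F \<noteq> bot" "\<forall>\<^sub>F e in F. norm e \<le> 1"
    "\<And>a. ((\<lambda>e. a * e) \<longlongrightarrow> a) F" "\<And>a. ((\<lambda>e. e * a) \<longlongrightarrow> a) F"
    using au unfolding approximately_unital_def by metis
  obtain q :: "('m \<Rightarrow> complex) \<Rightarrow> 'e" where q: "Lp_quotient p M q"
    using M p(1) unfolding is_Lp_space_def Lp_quotient_def by blast
  define A where "A a = blinfun_apply (\<phi> a)" for a
  \<comment> \<open>The essential subspace, where the approximate identity converges strongly to the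
    identity. It contains every \<open>A b \<xi>\<close>.\<close>
  define E where "E = {\<xi>. ((\<lambda>e. A e \<xi>) \<longlongrightarrow> \<xi>) F}"
  \<comment> \<open>The operator of \<open>a + \<mu>1\<close>, the scalar acting as a multiple of
    the identity.\<close>
  define B where "B x \<xi> = A (fst x) \<xi> + snd x *\<^sub>C \<xi>" for x \<xi>
  have rep: "representation \<phi>" and norm_\<phi>: "norm (\<phi> a) = norm a" for a
    using \<phi> by (auto simp: isometric_representation_def)
  have A_add_left: "A (a + b) \<xi> = A a \<xi> + A b \<xi>" for a b \<xi>
    using rep by (simp add: A_def representation_def blinfun.add_left)
  have A_scaleC_left: "A (c *\<^sub>C a) \<xi> = c *\<^sub>C A a \<xi>" for c a \<xi>
    using rep by (simp add: A_def representation_def)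
  have A_mult: "A (a * b) \<xi> = A a (A b \<xi>)" for a b \<xi>
    using rep by (simp add: A_def representation_def)
  have A_scaleC: "A a (c *\<^sub>C \<xi>) = c *\<^sub>C A a \<xi>" for c a \<xi>
    using rep by (simp add: A_def representation_def)
  have A_diff_left: "A (a - b) \<xi> = A a \<xi> - A b \<xi>" for a b \<xi>
    using A_add_left[of "a - b" b \<xi>] by simp
  have A_add: "A a (\<xi> + \<eta>) = A a \<xi> + A a \<eta>" and A_diff: "A a (\<xi> - \<eta>) = A a \<xi> - A a \<eta>"
    and A_scaleR: "A a (r *\<^sub>R \<xi>) = r *\<^sub>R A a \<xi>" for a \<xi> \<eta> r
    by (simp_all add: A_def blinfun.add_right blinfun.diff_right blinfun.scaleR_right)
  have A_le: "norm (A a \<xi>) \<le> norm a * norm \<xi>" for a \<xi>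
    unfolding A_def norm_\<phi>[symmetric] by (rule norm_blinfun)
  have A_contr: "norm (A a \<xi>) \<le> norm \<xi>" if "norm a \<le> 1" for a \<xi>
    using A_le[of a \<xi>] mult_right_mono[OF that norm_ge_zero[of \<xi>]] by simp
  have A_eqI: "a = b" if "\<And>\<xi>. A a \<xi> = A b \<xi>" for a b
  proof -
    have "norm (\<phi> (a - b)) \<le> 0"
      by (rule norm_blinfun_bound) (use that in \<open>simp_all add: A_diff_left flip: A_def\<close>)
    then show ?thesis by (simp add: norm_\<phi>)
  qed
  have tendsto_A_left: "((\<lambda>e. A (h e) \<xi>) \<longlongrightarrow> A a \<xi>) F" if "(h \<longlongrightarrow> a) F" for h a \<xi>
  proof -
    have "((\<lambda>e. A (h e - a) \<xi>) \<longlongrightarrow> 0) F"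
    proof (rule Lim_null_comparison)
      show "\<forall>\<^sub>F e in F. norm (A (h e - a) \<xi>) \<le> norm (h e - a) * norm \<xi>" using A_le by simp
      show "((\<lambda>e. norm (h e - a) * norm \<xi>) \<longlongrightarrow> 0) F"
        using that by (intro tendsto_mult_left_zero tendsto_norm_zero LIM_zero)
    qed
    then show ?thesis by (simp add: A_diff_left LIM_zero_iff)
  qed
  have tendsto_A: "((\<lambda>e. A a (h e)) \<longlongrightarrow> A a \<xi>) F" if "(h \<longlongrightarrow> \<xi>) F" for h a \<xi>
    unfolding A_def by (intro blinfun.tendsto tendsto_const that)
  have A_E: "A b \<xi> \<in> E" for b \<xi>
    using tendsto_A_left[OF F(4), of b \<xi>] by (simp add: E_def A_mult)
  have E_add: "\<xi> + \<eta> \<in> E" if "\<xi> \<in> E" "\<eta> \<in> E" for \<xi> \<eta>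
    using that by (auto simp: E_def A_add intro: tendsto_add)
  have E_scaleC: "c *\<^sub>C \<xi> \<in> E" if "\<xi> \<in> E" for c \<xi>
    using that by (auto simp: E_def A_scaleC intro: tendsto_scaleC)
  have B_E: "B x \<xi> \<in> E" if "\<xi> \<in> E" for x \<xi>
    unfolding B_def by (intro E_add A_E E_scaleC that)
  have B_act: "B x (A b \<xi>) = A (act x b) \<xi>" for x b \<xi>
    by (simp add: B_def act_def A_add_left A_mult A_scaleC_left)
  \<comment> \<open>On \<open>A e \<xi>\<close> the operator \<open>B x\<close> acts through
    \<open>act x e\<close>, which is contractive for contractive \<open>e\<close>, and these vectors
    converge to \<open>\<xi>\<close>.\<close>
  have B_le: "norm (B x \<xi>) \<le> norm \<xi>" if x: "\<And>b. norm (act x b) \<le> norm b" and \<xi>: "\<xi> \<in> E" for x \<xi>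
  proof (rule tendsto_upperbound[OF tendsto_norm _ F(1)])
    show "((\<lambda>e. B x (A e \<xi>)) \<longlongrightarrow> B x \<xi>) F"
      unfolding B_def using \<xi> by (intro tendsto_add tendsto_A tendsto_scaleC) (auto simp: E_def)
    show "\<forall>\<^sub>F e in F. norm (B x (A e \<xi>)) \<le> norm \<xi>"
      using F(2)
    proof eventually_elim
      case (elim e)
      have "norm (B x (A e \<xi>)) \<le> norm (act x e) * norm \<xi>" unfolding B_act by (rule A_le)
      also have "\<dots> \<le> 1 * norm \<xi>"
        using x[of e] elim by (intro mult_right_mono) auto
      finally show ?case by simp
    qed
  qed
  \<comment> \<open>For \<open>p > 1\<close> the approximate identity serves as \<open>T\<close>.
    For \<open>p = 1\<close> nondegeneracy makes \<open>E\<close> the whole space, and the identity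
    serves.\<close>
  have "\<exists>T :: 'a \<Rightarrow> 'e \<Rightarrow> 'e. Lp_subspace p M q E T F"
  proof (cases "p > 1")
    case True
    have "((\<lambda>e. sderiv p k (A e \<xi>)) \<longlongrightarrow> sderiv p k \<xi>) F" if "k \<in> E" for k \<xi>
    proof (rule Lp_quotient.tendsto_sderiv_contractions[OF q True])
      show "linear (A e)" for e by (rule linearI) (simp_all add: A_add A_scaleR)
      show "\<forall>\<^sub>F e in F. \<forall>\<xi>. norm (A e \<xi>) \<le> norm \<xi>"
        using F(2) by eventually_elim (blast intro: A_contr)
    qed (use that in \<open>simp add: E_def\<close>)
    then have "Lp_subspace p M q E A F"
      unfolding Lp_subspace_def Lp_subspace_axioms_def
      using q p E_add E_scaleC F(1) A_E A_scaleC by blast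
    then show ?thesis by blast
  next
    case False
    have "\<xi> \<in> E" for \<xi>
    proof -
      have sp: "\<eta> \<in> E" if "\<eta> \<in> span {blinfun_apply (\<phi> a) x | a x. True}" for \<eta>
        using that
      proof (induction rule: span_induct_alt)
        case base
        then show ?case using A_E[of 0 0] by (simp add: A_def)
      next
        case (step c x y)
        then obtain a z where "x = A a z" by (auto simp: A_def)
        then show ?case
          using E_add[OF E_scaleC[OF A_E[of a z], of "of_real c"] step(2)] by (simp add: scaleC_of_real)
      qed
      have "((\<lambda>e. A e \<xi>) \<longlongrightarrow> \<xi>) F"
      proof (rule tendstoI)
        fix \<epsilon> :: real assume "0 < \<epsilon>"
        moreover have "\<xi> \<in> closure (span {blinfun_apply (\<phi> a) x | a x. True})"
          using nd False by (simp add: nondegenerate_def)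
        ultimately obtain \<eta> where \<eta>: "\<eta> \<in> E" "norm (\<eta> - \<xi>) < \<epsilon> / 3"
          using sp closure_approachable[of \<xi>] by (metis dist_norm zero_less_divide_iff zero_less_numeral)
        have "\<forall>\<^sub>F e in F. dist (A e \<eta>) \<eta> < \<epsilon> / 3"
          using \<eta>(1) \<open>0 < \<epsilon>\<close> unfolding E_def by (intro tendstoD) auto
        then show "\<forall>\<^sub>F e in F. dist (A e \<xi>) \<xi> < \<epsilon>"
          using F(2)
        proof eventually_elim
          case (elim e)
          have eq: "A e \<xi> - \<xi> = (A e \<eta> - \<eta>) + ((\<eta> - \<xi>) - A e (\<eta> - \<xi>))" by (simp add: A_diff)
          have "norm (A e \<xi> - \<xi>) \<le> norm (A e \<eta> - \<eta>) + (norm (\<eta> - \<xi>) + norm (A e (\<eta> - \<xi>)))"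
            unfolding eq by (intro norm_triangle_mono norm_triangle_ineq4 order_refl)
          moreover have "norm (A e (\<eta> - \<xi>)) \<le> norm (\<eta> - \<xi>)"
            by (rule A_contr[OF elim(2)])
          ultimately show ?case using elim(1) \<eta>(2) by (simp add: dist_norm)
        qed
      qed
      then show ?thesis by (simp add: E_def)
    qed
    then have "Lp_subspace p M q E (\<lambda>_ \<xi>. \<xi>) F"
      unfolding Lp_subspace_def Lp_subspace_axioms_def using q p F(1) by auto
    then show ?thesis by blast
  qed
  then obtain T :: "'a \<Rightarrow> 'e \<Rightarrow> 'e" where "Lp_subspace p M q E T F" by blast
  then interpret Lp_subspace p M q E T F .
  have proj: "hermitian_projection (A e)" if e: "hermitian_idempotent e" for e :: 'a
  proof -
    have ee: "e * e = e" and en: "\<And>z b. cmod z = 1 \<Longrightarrow> norm (b + (z - 1) *\<^sub>C (e * b)) \<le> norm b"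
      using e unfolding hermitian_idempotent_iff[OF au] by auto
    have PP: "A e (A e \<xi>) = A e \<xi>" for \<xi> by (simp add: ee flip: A_mult)
    have le: "norm (A e \<xi> + z *\<^sub>C (\<xi> - A e \<xi>)) \<le> norm \<xi>" if \<xi>: "\<xi> \<in> E" and z: "cmod z = 1" for \<xi> z
    proof -
      have z1: "z * cnj z = 1" using z by (metis complex_norm_square of_real_1 power_one)
      \<comment> \<open>Up to the unimodular factor \<open>z\<close>, the operator of
        \<open>1 + (cnj z - 1) e\<close> is \<open>P + z (1 - P)\<close> with
        \<open>P = A e\<close>.\<close>
      have "norm (B ((cnj z - 1) *\<^sub>C e, 1) \<xi>) \<le> norm \<xi>"
        by (rule B_le[OF _ \<xi>]) (use en[of "cnj z"] z
            in \<open>simp add: act_def mult_scaleC_left scaleC_one add.commute\<close>)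
      moreover have "z *\<^sub>C B ((cnj z - 1) *\<^sub>C e, 1) \<xi> = A e \<xi> + z *\<^sub>C (\<xi> - A e \<xi>)"
        by (simp add: B_def A_scaleC_left A_diff_left scaleC_one scaleC_add_right
            scaleC_diff_right scaleC_diff_left
            scaleC_scaleC z1)
      ultimately show ?thesis using z by (metis mult_1 norm_scaleC)
    qed
    have "norm (A e \<xi> + z *\<^sub>C (\<xi> - A e \<xi>)) = norm \<xi>" if \<xi>: "\<xi> \<in> E" and z: "cmod z = 1" for \<xi> z
    proof (rule antisym[OF le[OF \<xi> z]])
      have z1: "cnj z * z = 1" using z by (metis complex_norm_square mult.commute of_real_1 power_one)
      \<comment> \<open>The rotation by \<open>cnj z\<close> takes \<open>\<eta>\<close> back to
        \<open>\<xi>\<close>, which gives the reverse inequality.\<close>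
      define \<eta> where "\<eta> = A e \<xi> + z *\<^sub>C (\<xi> - A e \<xi>)"
      have "A e \<eta> = A e \<xi>" by (simp add: \<eta>_def A_add A_scaleC A_diff PP)
      then have "A e \<eta> + cnj z *\<^sub>C (\<eta> - A e \<eta>) = \<xi>"
        by (simp add: \<eta>_def scaleC_scaleC z1 scaleC_one)
      moreover have "\<eta> \<in> E" unfolding \<eta>_def by (intro E_add E_scaleC E_diff A_E \<xi>)
      ultimately show "norm \<xi> \<le> norm (A e \<xi> + z *\<^sub>C (\<xi> - A e \<xi>))"
        using le[of \<eta> "cnj z"] z by (simp add: \<eta>_def)
    qed
    then show ?thesis unfolding hermitian_projection_def using A_E PP A_add A_scaleC by blast
  qed
  have "ultrahermitian e" if e: "hermitian_idempotent e" for e :: 'a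
  proof -
    have ee: "e * e = e" using e by (simp add: hermitian_idempotent_def)
    have PP: "A e (A e \<xi>) = A e \<xi>" for \<xi> by (simp add: ee flip: A_mult)
    \<comment> \<open>Additivity of the \<open>p\<close>-th power across range and kernel also makes
      both components contractive.\<close>
    have split: "norm (A e \<xi>) powr p + norm (\<eta> - A e \<eta>) powr p = norm (A e \<xi> + (\<eta> - A e \<eta>)) powr p"
      if "\<eta> \<in> E" for \<xi> \<eta>
      using norm_powr_add[OF proj[OF e], of "A e \<xi>" "\<eta> - A e \<eta>"] that by (simp add: A_E E_diff A_diff PP)
    have contr: "norm (A e \<xi>) powr p \<le> norm \<xi> powr p" "norm (\<xi> - A e \<xi>) powr p \<le> norm \<xi> powr p"
        if "\<xi> \<in> E" for \<xi>
    proof -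
      have "norm (A e \<xi>) powr p + norm (\<xi> - A e \<xi>) powr p = norm \<xi> powr p"
        using split[OF that, of \<xi>] by simp
      then show "norm (A e \<xi>) powr p \<le> norm \<xi> powr p" "norm (\<xi> - A e \<xi>) powr p \<le> norm \<xi> powr p"
        using powr_ge_zero[of "norm (A e \<xi>)" p] powr_ge_zero[of "norm (\<xi> - A e \<xi>)" p] by linarith+
    qed
    \<comment> \<open>The contractions \<open>x\<close> and \<open>y\<close> act separately on the
      two components of \<open>\<zeta>\<close>, and the outer compressions keep the results in range
      and kernel, so the bounds add as \<open>p\<close>-th powers.\<close>
    have "norm (e * act x (e * b) + (act y (b - e * b) - e * act y (b - e * b))) \<le> norm b"
      if x: "\<And>b. norm (act x b) \<le> norm b" and y: "\<And>b. norm (act y b) \<le> norm b" for x y b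
      unfolding norm_\<phi>[symmetric, of "e * act x (e * b) + _"]
    proof (rule norm_blinfun_bound)
      fix \<xi>
      define \<zeta> where "\<zeta> = A b \<xi>"
      have \<zeta>: "\<zeta> \<in> E" "A e \<zeta> \<in> E" "\<zeta> - A e \<zeta> \<in> E" by (simp_all add: \<zeta>_def A_E E_diff)
      define \<alpha> \<beta> where "\<alpha> = B x (A e \<zeta>)" and "\<beta> = B y (\<zeta> - A e \<zeta>)"
      have E: "\<alpha> \<in> E" "\<beta> \<in> E" unfolding \<alpha>_def \<beta>_def by (intro B_E \<zeta>)+
      have "blinfun_apply (\<phi> (e * act x (e * b) + (act y (b - e * b) - e * act y (b - e * b)))) \<xi>
          = A e \<alpha> + (\<beta> - A e \<beta>)"
        by (simp add: A_add_left A_diff_left A_mult B_act \<alpha>_def \<beta>_def \<zeta>_def flip: A_def)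
          (simp add: A_add_left A_diff_left A_mult flip: B_act)
      also have "norm \<dots> powr p = norm (A e \<alpha>) powr p + norm (\<beta> - A e \<beta>) powr p"
        by (rule split[OF E(2), symmetric])
      also have "\<dots> \<le> norm \<alpha> powr p + norm \<beta> powr p"
        by (intro add_mono contr E)
      also have "\<dots> \<le> norm (A e \<zeta>) powr p + norm (\<zeta> - A e \<zeta>) powr p"
        unfolding \<alpha>_def \<beta>_def using p by (intro add_mono powr_mono2 B_le x y \<zeta>) auto
      also have "\<dots> = norm \<zeta> powr p" using split[OF \<zeta>(1), of \<zeta>] by simp
      finally have "norm (blinfun_apply (\<phi> (e * act x (e * b) + (act y (b - e * b) - e * act y (b
          - e * b)))) \<xi>)
          \<le> norm \<zeta>"
        using p powr_less_mono2[of p "norm \<zeta>"] by (meson norm_ge_zero not_le order_less_le_trans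
            zero_less_one)
      also have "\<dots> \<le> norm b * norm \<xi>" unfolding \<zeta>_def by (rule A_le)
      finally show "norm (blinfun_apply (\<phi> (e * act x (e * b) + (act y (b - e * b) - e * act y (b
          - e * b)))) \<xi>)
          \<le> norm b * norm \<xi>" .
    qed simp
    then show ?thesis unfolding ultrahermitian_iff[OF ee] by blast
  qed
  moreover have "e * f = f * e" if e: "hermitian_idempotent e" and f: "hermitian_idempotent f"
      for e f :: 'a
  proof -
    \<comment> \<open>The projections are known to commute only on \<open>E\<close>, so they are
      applied to vectors \<open>A b \<xi>\<close>; faithfulness then removes
      \<open>b\<close>.\<close>
    have "act (e * f - f * e, 0) b = 0" for b
    proof -
      have "A (e * f * b) \<xi> = A (f * e * b) \<xi>" for \<xi>
        using hermitian_projections_commute[OF proj[OF e] proj[OF f] A_E[of b \<xi>]] by (simp add: A_mult)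
      then have "e * f * b = f * e * b" by (rule A_eqI)
      then show ?thesis by (simp add: left_diff_distrib)
    qed
    then have "(e * f - f * e, 0 :: complex) = 0"
      by (intro act_faithful[OF au]) simp_all
    then show ?thesis by (simp add: zero_prod_def)
  qed
  ultimately show ?thesis
    unfolding hermitian_idempotents_ultrahermitian_and_commute_def by blast
qed

theorem theorem2p28:
  assumes "approximately_unital TYPE('a::complex_banach_algebra)"
  shows
    "(hermitian_idempotents_ultrahermitian_and_commute TYPE('a) \<longrightarrow>
        (\<forall>a a' b b'::'a. homotopic a a' \<longrightarrow> homotopic b b' \<longrightarrow> homotopic (a * b) (a' * b')) \<and>
        (\<forall>a\<in>PI_MP. \<forall>b\<in>PI_MP. S_pi_mult (pi_class a) (pi_class b) = pi_class (a * b :: 'a)) \<and>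
        inverse_semigroup (S_pi :: 'a set set) S_pi_mult \<and>
        (\<forall>a\<in>PI_MP. dagger S_pi S_pi_mult (pi_class a) = pi_class (mp_inverse a :: 'a)) \<and>
        inverse_semigroup_hom (PI_MP :: 'a set) (*) S_pi S_pi_mult pi_class) \<and>
     (\<forall>p. 1 < p \<and> p \<noteq> 2 \<and> Lp_operator_algebra TYPE('a) TYPE('e::complex_banach) TYPE('m) p \<longrightarrow>
        hermitian_idempotents_ultrahermitian_and_commute TYPE('a)) \<and>
     (nondegenerate_Lp_operator_algebra TYPE('a) TYPE('f::complex_banach) TYPE('n) 1 \<longrightarrow>
        hermitian_idempotents_ultrahermitian_and_commute TYPE('a))"
proof (intro conjI impI allI ballI)
  assume uh: "hermitian_idempotents_ultrahermitian_and_commute TYPE('a)"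
  note au_uh = assms uh
  show "homotopic (a * b) (a' * b')" if "homotopic a a'" "homotopic b b'" for a a' b b' :: 'a
    by (rule homotopic_mult[OF au_uh that])
  show "S_pi_mult (pi_class a) (pi_class b) = pi_class (a * b)" if "a \<in> PI_MP" "b \<in> PI_MP" for a b :: 'a
    by (rule S_pi_mult_pi_class[OF au_uh that])
  show "inverse_semigroup (S_pi :: 'a set set) S_pi_mult"
    by (rule inverse_semigroup_S_pi(1)[OF au_uh])
  show "dagger S_pi S_pi_mult (pi_class a) = pi_class (mp_inverse a)" if "a \<in> PI_MP" for a :: 'a
    by (rule inverse_semigroup_S_pi(2)[OF au_uh that])
  show "inverse_semigroup_hom (PI_MP :: 'a set) (*) S_pi S_pi_mult pi_class"
    by (rule inverse_semigroup_hom_pi_class[OF au_uh])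
next
  fix p :: real
  assume p: "1 < p \<and> p \<noteq> 2 \<and> Lp_operator_algebra TYPE('a) TYPE('e) TYPE('m) p"
  then obtain M :: "'m measure" and \<phi> :: "'a \<Rightarrow> 'e \<Rightarrow>\<^sub>L 'e"
    where "is_Lp_space TYPE('e) p M" "isometric_representation \<phi>"
    by (auto simp: Lp_operator_algebra_def)
  then show "hermitian_idempotents_ultrahermitian_and_commute TYPE('a)"
    using p by (intro Lp_operator_algebra_hermitian_idempotents[OF assms, of p M \<phi>]) auto
next
  assume "nondegenerate_Lp_operator_algebra TYPE('a) TYPE('f) TYPE('n) 1"
  then obtain M :: "'n measure" and \<phi> :: "'a \<Rightarrow> 'f \<Rightarrow>\<^sub>L 'f"
    where "is_Lp_space TYPE('f) 1 M" "isometric_representation \<phi>" "nondegenerate \<phi>"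
    by (auto simp: nondegenerate_Lp_operator_algebra_def)
  then show "hermitian_idempotents_ultrahermitian_and_commute TYPE('a)"
    by (intro Lp_operator_algebra_hermitian_idempotents[OF assms, of 1 M \<phi>]) auto
qed

end
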